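(* Let $(X_j)_{1\le j\le n}$ be a vector of centered real random variables defined on a probability space $(\Omega,\mathcal{K},P)$ and adapted to an increasing filtration $(\mathcal{F}_j)_{1\le j\le n}$ of sub-$\sigma$-fields of $\mathcal{K}$, with $\mathcal{F}_0=\{\varnothing,\Omega\}$. Let $S_j=\sum_{i=1}^jX_i$ and $A_{n,j}=\mathbf{E}(S_n-S_j\mid\mathcal{F}_j)$, and let $\rho_k$ be the maximal correlation coefficients of the vector, as defined in the context. Let $p\ge2$ be a real number and assume the variables have finite moments of order $p$. Then $$\sum_{j=1}^n\mathbf{E}|A_{n,j}|^p\le 2^{p-2}\Big(\sum_{k=1}^{n-1}\rho_k^{2/p}\Big)^p\sum_{i=1}^n\mathbf{E}|X_i|^p.$$ If for a certain $0<\rho<1$ we have $\rho_k\le\rho^k$, then, for any $p\ge2$, $$\sum_{j=1}^n\mathbf{E}|A_{n,j}|^p\le p^p\,\frac{1}{4(1-\rho)^p}\sum_{i=1}^n\mathbf{E}|X_i|^p.$$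
   Context: For sub-$\sigma$-algebras $\mathcal{A},\mathcal{B}$ of $\mathcal{K}$, the maximal coefficient of correlation is $$\rho(\mathcal{A},\mathcal{B})=\sup_{f\in \mathbf{L}_2(\mathcal{A}),\,g\in \mathbf{L}_2(\mathcal{B})}|\mathrm{corr}(f,g)|,$$ where $\mathbf{L}_2(\mathcal{A})$ is the space of random variables that are $\mathcal{A}$-measurable and square integrable. For a vector of random variables $(Y_k)_{1\le k\le n}$ one defines $$\rho_k=\max_{1\le s,\ s+k\le n}\rho\big(\sigma(Y_i,\ i\le s),\sigma(Y_j,\ j\ge s+k)\big).$$ In the claim, $\rho_k$ is given by this formula with $(Y_k)=(X_k)$.
   Formalization: Adds the hypothesis that the maximal correlation of F_s with σ(X_j, j≥s+k) is at most ρ_k (automatic for the natural filtration); without it the claim fails, e.g. n=2, X_1=0, X_2 a fair sign, F_1=F_2=σ(X_2). *)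

theory Defs
  imports "HOL-Probability.Probability"
begin

text \<open>The \<open>\<sigma>\<close>-algebra on \<^term>\<open>space M\<close> generated by the real random variables
  \<open>Y i\<close>, \<open>i \<in> I\<close>.\<close>

definition generated_sigma ::
    "'a measure \<Rightarrow> ('i \<Rightarrow> 'a \<Rightarrow> real) \<Rightarrow> 'i set \<Rightarrow> 'a measure" where
  "generated_sigma M Y I =
     sigma (space M) (\<Union>i\<in>I. {Y i -` B \<inter> space M | B. B \<in> sets borel})"

definition L2_space :: "'a measure \<Rightarrow> 'a measure \<Rightarrow> ('a \<Rightarrow> real) set" where
  "L2_space M A = {f \<in> borel_measurable A. integrable M (\<lambda>x. (f x)\<^sup>2)}"

text \<open>If \<open>f\<close> or \<open>g\<close> is almost surely constant, the denominator vanishes and the value is 0,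
  by \<open>x / 0 = 0\<close>.\<close>

definition corr :: "'a measure \<Rightarrow> ('a \<Rightarrow> real) \<Rightarrow> ('a \<Rightarrow> real) \<Rightarrow> real" where
  "corr M f g =
     (\<integral>x. (f x - (\<integral>y. f y \<partial>M)) * (g x - (\<integral>y. g y \<partial>M)) \<partial>M) /
     (sqrt (\<integral>x. (f x - (\<integral>y. f y \<partial>M))\<^sup>2 \<partial>M) * sqrt (\<integral>x. (g x - (\<integral>y. g y \<partial>M))\<^sup>2 \<partial>M))"

text \<open>For a probability measure \<open>M\<close> and sub-\<open>\<sigma>\<close>-algebras \<open>A\<close>, \<open>B\<close> this is the supremum of a
  nonempty set (constants are square integrable) bounded by 1 (Cauchy-Schwarz).\<close>

definition max_corr :: "'a measure \<Rightarrow> 'a measure \<Rightarrow> 'a measure \<Rightarrow> real" where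
  "max_corr M A B = Sup {\<bar>corr M f g\<bar> | f g. f \<in> L2_space M A \<and> g \<in> L2_space M B}"

text \<open>The maximum is over a nonempty finite set for \<open>1 \<le> k \<le> n - 1\<close>, the only values of \<open>k\<close>
  for which the coefficient is used.\<close>

definition rho_coeff :: "'a measure \<Rightarrow> nat \<Rightarrow> (nat \<Rightarrow> 'a \<Rightarrow> real) \<Rightarrow> nat \<Rightarrow> real" where
  "rho_coeff M n Y k =
     Max ((\<lambda>s. max_corr M (generated_sigma M Y {1..s}) (generated_sigma M Y {s+k..n}))
            ` {s. 1 \<le> s \<and> s + k \<le> n})"

definition partial_sum :: "(nat \<Rightarrow> 'a \<Rightarrow> real) \<Rightarrow> nat \<Rightarrow> 'a \<Rightarrow> real" where
  "partial_sum X j x = (\<Sum>i=1..j. X i x)"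

definition A_cond ::
    "'a measure \<Rightarrow> (nat \<Rightarrow> 'a measure) \<Rightarrow> (nat \<Rightarrow> 'a \<Rightarrow> real) \<Rightarrow> nat \<Rightarrow> nat \<Rightarrow> 'a \<Rightarrow> real" where
  "A_cond M F X n j =
     real_cond_exp M (F j) (\<lambda>x. partial_sum X n x - partial_sum X j x)"

text \<open>The coefficients of \<^const>\<open>rho_coeff\<close> only see the past \<open>\<sigma>(X\<^sub>i, i \<le> s)\<close> of the vector,
  whereas \<^const>\<open>A_cond\<close> conditions on \<open>F s\<close>, which adaptedness only forces to be larger.
  If \<open>F s\<close> is allowed to look into the future, no bound of the latter by the former can hold:
  take \<open>n = 2\<close>, \<open>X 1 = 0\<close>, \<open>X 2\<close> a fair random sign and \<open>F 1 = F 2 = \<sigma>(X 2)\<close>; then the first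
  coefficient is 0, although \<open>E(X 2 | F 1) = X 2\<close>. The following condition excludes this: it
  says that the coefficients do not increase when \<open>\<sigma>(X\<^sub>i, i \<le> s)\<close> is replaced by \<open>F s\<close>.
  The natural filtration satisfies it.\<close>

definition rho_compatible ::
    "'a measure \<Rightarrow> nat \<Rightarrow> (nat \<Rightarrow> 'a measure) \<Rightarrow> (nat \<Rightarrow> 'a \<Rightarrow> real) \<Rightarrow> bool" where
  "rho_compatible M n F X \<longleftrightarrow>
     (\<forall>s k. 1 \<le> s \<and> 1 \<le> k \<and> s + k \<le> n \<longrightarrow>
        max_corr M (F s) (generated_sigma M X {s+k..n}) \<le> rho_coeff M n X k)"

lemma rho_compatible_natural_filtration:
  assumes "\<And>s. 1 \<le> s \<Longrightarrow> s \<le> n \<Longrightarrow> sets (F s) = sets (generated_sigma M X {1..s})"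
  shows "rho_compatible M n F X"
  unfolding rho_compatible_def
proof (intro allI impI)
  fix s k :: nat
  assume sk: "1 \<le> s \<and> 1 \<le> k \<and> s + k \<le> n"
  have "(borel_measurable (F s) :: (_ \<Rightarrow> real) set) =
      borel_measurable (generated_sigma M X {1..s})"
    using sk by (intro measurable_cong_sets assms) auto
  then have "L2_space M (F s) = L2_space M (generated_sigma M X {1..s})"
    by (simp only: L2_space_def)
  then have eq: "max_corr M (F s) (generated_sigma M X {s+k..n}) =
      max_corr M (generated_sigma M X {1..s}) (generated_sigma M X {s+k..n})"
    by (simp only: max_corr_def)
  have "finite {s. 1 \<le> s \<and> s + k \<le> n}"
    by (rule finite_subset[of _ "{..n}"]) auto
  then show "max_corr M (F s) (generated_sigma M X {s+k..n}) \<le> rho_coeff M n X k"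
    unfolding eq rho_coeff_def using sk by (intro Max_ge) auto
qed

end

theory Submission
  imports Defs "HOL-Complex_Analysis.Conformal_Mappings"
begin

text \<open>On functions \<open>f\<close> of \<open>X\<^sub>i\<close>, \<open>i \<ge> j + k\<close>, the operator
  \<open>f \<mapsto> E(f | F\<^sub>j) - E f\<close> has norm at most \<open>\<rho>\<^sub>k\<close> on \<open>L\<^sub>2\<close> and at most \<open>2\<close> on \<open>L\<^sub>\<infinity>\<close>. Riesz-Thorin
  interpolation gives norm at most \<open>2\<^bsup>1-2/p\<^esup> \<rho>\<^sub>k\<^bsup>2/p\<^esup>\<close> on \<open>L\<^sub>p\<close>. With
  \<open>A\<^bsub>n,j\<^esub> = \<Sum>\<^sub>k E(X\<^bsub>j+k\<^esub> | F\<^sub>j)\<close>, the first bound is then Young's inequality for the convolution of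
  \<open>\<rho>\<^sub>k\<^bsup>2/p\<^esup>\<close> with the \<open>L\<^sub>p\<close> norms of the \<open>X\<^sub>i\<close>. For the second bound, Young's inequality for products gives
  \<open>1 - \<rho>\<^bsup>2/p\<^esup> \<ge> (2/p)(1 - \<rho>)\<close>, which controls the geometric series.\<close>

subsection \<open>Riesz-Thorin interpolation for finite matrices\<close>

lemma three_lines_unit:
  assumes hol: "\<Phi> holomorphic_on UNIV"
    and bdd: "\<And>z. 0 \<le> Re z \<Longrightarrow> Re z \<le> 1 \<Longrightarrow> norm (\<Phi> z) \<le> C"
    and left: "\<And>z. Re z = 0 \<Longrightarrow> norm (\<Phi> z) \<le> 1"
    and right: "\<And>z. Re z = 1 \<Longrightarrow> norm (\<Phi> z) \<le> 1"
    and w: "0 \<le> Re w" "Re w \<le> 1"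
  shows "norm (\<Phi> w) \<le> 1"
proof -
  \<comment> \<open>Damping by \<open>exp (e (z\<^sup>2 - 1))\<close> makes the function small at the far ends of the strip, so that
    the maximum modulus principle on a rectangle applies; then \<open>e\<close> tends to \<open>0\<close>.\<close>
  define c where "c = (Re w)\<^sup>2 - (Im w)\<^sup>2 - 1"
  have key: "norm (\<Phi> w) * exp (e * c) \<le> 1" if e: "e > 0" for e :: real
  proof -
    define G where "G = (\<lambda>z. \<Phi> z * exp (of_real e * (z\<^sup>2 - 1)))"
    have nG: "norm (G z) = norm (\<Phi> z) * exp (e * ((Re z)\<^sup>2 - (Im z)\<^sup>2 - 1))" for z
      by (simp add: G_def norm_mult power2_eq_square)
    have C0: "C \<ge> 0" using bdd[OF w] norm_ge_zero order_trans by blast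
    \<comment> \<open>The first entry of the maximum puts \<open>w\<close> inside the rectangle. The
      second gives \<open>C <= e * R^2 <= exp (e * R^2)\<close>, so on the horizontal sides the
      damping factor absorbs the crude bound \<open>C\<close>.\<close>
    define R where "R = max \<bar>Im w\<bar> (sqrt (C / e)) + 1"
    have R0: "R > 0" unfolding R_def by (smt (verit) abs_ge_zero)
    have "C / e = (sqrt (C / e))\<^sup>2" using C0 e by simp
    also have "\<dots> \<le> R\<^sup>2" unfolding R_def by (intro power_mono) (use C0 e in auto)
    finally have CR: "C \<le> e * R\<^sup>2" using e by (simp add: field_simps)
    define S where "S = cbox (Complex 0 (-R)) (Complex 1 R)"
    have wS: "w \<in> S" using w by (auto simp: S_def in_cbox_complex_iff R_def)
    have "norm (G w) \<le> 1"
    proof (rule maximum_modulus_frontier[OF _ _ _ _ wS])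
      have holG: "G holomorphic_on UNIV" unfolding G_def by (intro holomorphic_intros hol)
      then show "G holomorphic_on interior S" by (rule holomorphic_on_subset) auto
      show "continuous_on (closure S) G"
        using holG by (intro holomorphic_on_imp_continuous_on) (rule holomorphic_on_subset, auto)
      show "bounded S" unfolding S_def by simp
      fix z assume "z \<in> frontier S"
      then have z: "z \<in> cbox (Complex 0 (-R)) (Complex 1 R)" "z \<notin> box (Complex 0 (-R)) (Complex 1 R)"
        unfolding S_def by (auto simp: frontier_cbox)
      then have rz: "0 \<le> Re z" "Re z \<le> 1" "Re z = 0 \<or> Re z = 1 \<or> (Im z)\<^sup>2 = R\<^sup>2"
        by (auto simp: in_cbox_complex_iff in_box_complex_iff power2_eq_iff)
      \<comment> \<open>The \<open>- 1\<close> in the damping offsets \<open>(Re z)^2 <= 1\<close>,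
        so the damping factor is at most \<open>exp (- (e * (Im z)^2))\<close> and never above
        1.\<close>
      have "(Re z)\<^sup>2 \<le> 1" using rz by (simp add: power_le_one)
      then have le: "e * ((Re z)\<^sup>2 - (Im z)\<^sup>2 - 1) \<le> - (e * (Im z)\<^sup>2)"
        using e mult_left_mono[of "(Re z)\<^sup>2 - (Im z)\<^sup>2 - 1" "- (Im z)\<^sup>2" e] by simp
      have bound: "norm (G z) \<le> norm (\<Phi> z) * exp (- (e * (Im z)\<^sup>2))"
        unfolding nG using le by (intro mult_left_mono) auto
      show "norm (G z) \<le> 1"
      proof (cases "Re z = 0 \<or> Re z = 1")
        case True
        then have "norm (\<Phi> z) \<le> 1" using left right by auto
        moreover have "exp (- (e * (Im z)\<^sup>2)) \<le> 1" using e by simp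
        ultimately have "norm (\<Phi> z) * exp (- (e * (Im z)\<^sup>2)) \<le> 1"
          by (simp add: mult_le_one)
        then show ?thesis using bound by linarith
      next
        case False
        then have im: "(Im z)\<^sup>2 = R\<^sup>2" using rz by auto
        have "norm (\<Phi> z) \<le> C" using bdd rz by auto
        also have "\<dots> \<le> exp (e * R\<^sup>2)" using CR exp_ge_add_one_self[of "e * R\<^sup>2"] by linarith
        finally have "norm (\<Phi> z) * exp (- (e * (Im z)\<^sup>2)) \<le> exp (e * R\<^sup>2) * exp (- (e * R\<^sup>2))"
          unfolding im by (intro mult_right_mono) auto
        then show ?thesis using bound by (simp add: exp_minus)
      qed
    qed
    then show ?thesis unfolding nG c_def .
  qed
  have "((\<lambda>e. norm (\<Phi> w) * exp (e * c)) \<longlongrightarrow> norm (\<Phi> w) * exp (0 * c)) (at_right 0)"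
    by (intro tendsto_intros)
  then have "norm (\<Phi> w) * exp (0 * c) \<le> 1"
    by (rule tendsto_upperbound) (auto simp: eventually_at_right_less key intro: eventually_mono[OF eventually_at_right_less])
  then show ?thesis by simp
qed

text \<open>Multiplying by the exponential of \<open>- ((1 - z) * ln A + z * ln B)\<close> brings
  both edge bounds down to 1, so \<open>three_lines_unit\<close> applies. As \<open>A\<close> or
  \<open>B\<close> may be 0, the logarithms are taken of \<open>A + e\<close> and
  \<open>B + e\<close>, and \<open>e\<close> tends to 0 afterwards.\<close>

lemma three_lines:
  assumes hol: "\<Phi> holomorphic_on UNIV"
    and bdd: "\<And>z. 0 \<le> Re z \<Longrightarrow> Re z \<le> 1 \<Longrightarrow> norm (\<Phi> z) \<le> C"
    and left: "\<And>z. Re z = 0 \<Longrightarrow> norm (\<Phi> z) \<le> A"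
    and right: "\<And>z. Re z = 1 \<Longrightarrow> norm (\<Phi> z) \<le> B"
    and t: "0 < t" "t < 1"
  shows "norm (\<Phi> (of_real t)) \<le> A powr (1 - t) * B powr t"
proof -
  have A0: "A \<ge> 0" using order_trans[OF norm_ge_zero left[of 0]] by simp
  have B0: "B \<ge> 0" using order_trans[OF norm_ge_zero right[of 1]] by simp
  have key: "norm (\<Phi> (of_real t)) \<le> (A + e) powr (1 - t) * (B + e) powr t" if e: "e > 0" for e
  proof -
    define a where "a = ln (A + e)"
    define b where "b = ln (B + e)"
    define G where "G = (\<lambda>z. \<Phi> z * exp (- ((1 - z) * of_real a + z * of_real b)))"
    have nG: "norm (G z) = norm (\<Phi> z) * exp (- ((1 - Re z) * a + Re z * b))" for z
      by (simp add: G_def norm_mult)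
    have C0: "C \<ge> 0" using order_trans[OF norm_ge_zero bdd[of 0]] by simp
    have "norm (G (of_real t)) \<le> 1"
    proof (rule three_lines_unit[where C = "C * exp (\<bar>a\<bar> + \<bar>b\<bar>)" and \<Phi> = G])
      show "G holomorphic_on UNIV" unfolding G_def by (intro holomorphic_intros hol)
      show "0 \<le> Re (complex_of_real t)" "Re (complex_of_real t) \<le> 1" using t by auto
    next
      fix z assume z: "0 \<le> Re z" "Re z \<le> 1"
      have "\<bar>(1 - Re z) * a\<bar> \<le> \<bar>a\<bar>" "\<bar>Re z * b\<bar> \<le> \<bar>b\<bar>"
        using z by (auto simp: abs_mult intro: mult_left_le_one_le)
      then have "- ((1 - Re z) * a + Re z * b) \<le> \<bar>a\<bar> + \<bar>b\<bar>" by linarith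
      then show "norm (G z) \<le> C * exp (\<bar>a\<bar> + \<bar>b\<bar>)"
        unfolding nG using bdd[OF z] C0 by (intro mult_mono) auto
    next
      fix z assume "Re z = 0"
      then show "norm (G z) \<le> 1" unfolding nG using left[of z] A0 e
        by (simp add: a_def exp_minus field_simps)
    next
      fix z assume "Re z = 1"
      then show "norm (G z) \<le> 1" unfolding nG using right[of z] B0 e
        by (simp add: b_def exp_minus field_simps)
    qed
    then have "norm (\<Phi> (of_real t)) / exp ((1 - t) * a + t * b) \<le> 1"
      unfolding nG by (simp only: exp_minus divide_inverse Re_complex_of_real)
    then have "norm (\<Phi> (of_real t)) \<le> exp ((1 - t) * a + t * b)"
      by (simp only: pos_divide_le_eq exp_gt_zero mult_1)
    also have "\<dots> = (A + e) powr (1 - t) * (B + e) powr t"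
      using A0 B0 e by (simp add: powr_def a_def b_def exp_add)
    finally show ?thesis .
  qed
  \<comment> \<open>Strictness in \<open>0 < t < 1\<close> matters: a power with positive exponent
    is continuous at base 0, the limiting base when \<open>A\<close> or \<open>B\<close>
    vanishes.\<close>
  have "((\<lambda>e. (A + e) powr (1 - t) * (B + e) powr t) \<longlongrightarrow> (A + 0) powr (1 - t) * (B + 0) powr t) (at_right 0)"
    using A0 B0 t by (intro tendsto_mult tendsto_powr' tendsto_add tendsto_const tendsto_ident_at)
      (auto intro!: eventually_mono[OF eventually_at_right_less[of "0::real"]])
  then have "norm (\<Phi> (of_real t)) \<le> (A + 0) powr (1 - t) * (B + 0) powr t"
    by (rule tendsto_lowerbound) (auto intro!: key eventually_mono[OF eventually_at_right_less[of "0::real"]])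
  then show ?thesis by simp
qed

lemma sqrt_prod_add_le:
  fixes a b c d :: real
  assumes "0 \<le> a" "0 \<le> b" "0 \<le> c" "0 \<le> d"
  shows "sqrt a * sqrt b + sqrt c * sqrt d \<le> sqrt (a + c) * sqrt (b + d)"
proof -
  have "inner (sqrt a, sqrt c) (sqrt b, sqrt d) \<le> norm (sqrt a, sqrt c) * norm (sqrt b, sqrt d)"
    by (rule norm_cauchy_schwarz)
  then show ?thesis using assms by (simp add: norm_Pair)
qed

text \<open>Interpolation needs the \<open>L_2\<close> bound for complex vectors with the same
  constant. A unimodular factor absorbed into \<open>x\<close> makes the form real and nonnegative;
  it is then a form in the real parts minus one in the imaginary parts, and Cauchy-Schwarz in the
  plane recombines the two bounds without loss.\<close>

lemma bilinear_bound_complexify: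
  fixes c :: "'i \<Rightarrow> 'j \<Rightarrow> real" and x :: "'i \<Rightarrow> complex" and y :: "'j \<Rightarrow> complex"
  assumes u: "\<And>i. i \<in> I \<Longrightarrow> 0 \<le> u i" and v: "\<And>j. j \<in> J \<Longrightarrow> 0 \<le> v j" and r: "0 \<le> r"
    and L2: "\<And>x y :: _ \<Rightarrow> real. \<bar>\<Sum>i\<in>I. \<Sum>j\<in>J. c i j * x i * y j\<bar>
      \<le> r * (sqrt (\<Sum>i\<in>I. u i * (x i)\<^sup>2) * sqrt (\<Sum>j\<in>J. v j * (y j)\<^sup>2))"
  shows "norm (\<Sum>i\<in>I. \<Sum>j\<in>J. of_real (c i j) * x i * y j)
      \<le> r * (sqrt (\<Sum>i\<in>I. u i * (norm (x i))\<^sup>2) * sqrt (\<Sum>j\<in>J. v j * (norm (y j))\<^sup>2))"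
proof -
  define w where "w = (\<Sum>i\<in>I. \<Sum>j\<in>J. of_real (c i j) * x i * y j)"
  obtain \<theta> where \<theta>: "norm \<theta> = 1" "\<theta> * w = of_real (norm w)"
  proof (cases "w = 0")
    case True then show ?thesis using that[of 1] by simp
  next
    case False
    have "cnj w / of_real (norm w) * w = of_real (norm w)"
      using False complex_norm_square[of w] by (simp add: field_simps power2_eq_square)
    moreover have "norm (cnj w / of_real (norm w)) = 1" using False by (simp add: norm_divide)
    ultimately show ?thesis using that by blast
  qed
  define x' where "x' = (\<lambda>i. \<theta> * x i)"
  have nx: "norm (x' i) = norm (x i)" for i by (simp add: x'_def norm_mult \<theta>)
  have "\<theta> * w = (\<Sum>i\<in>I. \<Sum>j\<in>J. of_real (c i j) * x' i * y j)"
    unfolding w_def x'_def by (simp add: sum_distrib_left mult_ac)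
  then have "Re (of_real (norm w)) = Re (\<Sum>i\<in>I. \<Sum>j\<in>J. of_real (c i j) * x' i * y j)"
    unfolding \<theta>(2) by (rule arg_cong)
  then have "norm w = (\<Sum>i\<in>I. \<Sum>j\<in>J. c i j * Re (x' i) * Re (y j))
      - (\<Sum>i\<in>I. \<Sum>j\<in>J. c i j * Im (x' i) * Im (y j))"
    by (simp add: sum_subtractf mult_ac right_diff_distrib)
  also have "\<dots> \<le> r * (sqrt (\<Sum>i\<in>I. u i * (Re (x' i))\<^sup>2) * sqrt (\<Sum>j\<in>J. v j * (Re (y j))\<^sup>2))
      + r * (sqrt (\<Sum>i\<in>I. u i * (Im (x' i))\<^sup>2) * sqrt (\<Sum>j\<in>J. v j * (Im (y j))\<^sup>2))"
    using L2[of "\<lambda>i. Re (x' i)" "\<lambda>j. Re (y j)"] L2[of "\<lambda>i. Im (x' i)" "\<lambda>j. Im (y j)"] by linarith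
  also have "\<dots> \<le> r * (sqrt ((\<Sum>i\<in>I. u i * (Re (x' i))\<^sup>2) + (\<Sum>i\<in>I. u i * (Im (x' i))\<^sup>2))
      * sqrt ((\<Sum>j\<in>J. v j * (Re (y j))\<^sup>2) + (\<Sum>j\<in>J. v j * (Im (y j))\<^sup>2)))"
    unfolding distrib_left[symmetric] using r u v
    by (intro mult_left_mono sqrt_prod_add_le sum_nonneg mult_nonneg_nonneg) auto
  also have "\<dots> = r * (sqrt (\<Sum>i\<in>I. u i * (norm (x' i))\<^sup>2) * sqrt (\<Sum>j\<in>J. v j * (norm (y j))\<^sup>2))"
    by (simp add: sum.distrib[symmetric] distrib_left[symmetric] cmod_power2)
  finally show ?thesis unfolding nx w_def .
qed

text \<open>Interpolates between exponents \<open>(2, 2)\<close>, with bound \<open>r\<close>, and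
  \<open>(infinity, 1)\<close>, where the column sums give the bound \<open>K\<close>. With the
  conjugate exponent on \<open>y\<close>, the conclusion is the dual form of an operator norm bound
  on \<open>L_p\<close>. The weights \<open>u\<close> and \<open>v\<close> will be the laws of two
  simple functions.\<close>

lemma finite_riesz_thorin:
  fixes c :: "'i \<Rightarrow> 'j \<Rightarrow> real" and x :: "'i \<Rightarrow> real" and y :: "'j \<Rightarrow> real"
  assumes fin: "finite I" "finite J"
    and u: "\<And>i. i \<in> I \<Longrightarrow> 0 \<le> u i" and v: "\<And>j. j \<in> J \<Longrightarrow> 0 \<le> v j"
    and r: "0 \<le> r" and K: "0 < K" and p: "2 \<le> p"
    and L2: "\<And>x y :: _ \<Rightarrow> real. \<bar>\<Sum>i\<in>I. \<Sum>j\<in>J. c i j * x i * y j\<bar>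
      \<le> r * (sqrt (\<Sum>i\<in>I. u i * (x i)\<^sup>2) * sqrt (\<Sum>j\<in>J. v j * (y j)\<^sup>2))"
    and L1: "\<And>j. j \<in> J \<Longrightarrow> (\<Sum>i\<in>I. \<bar>c i j\<bar>) \<le> K * v j"
  shows "\<bar>\<Sum>i\<in>I. \<Sum>j\<in>J. c i j * x i * y j\<bar>
      \<le> K powr (1 - 2 / p) * r powr (2 / p) * (\<Sum>i\<in>I. u i * \<bar>x i\<bar> powr p) powr (1 / p)
        * (\<Sum>j\<in>J. v j * \<bar>y j\<bar> powr (p / (p - 1))) powr (1 - 1 / p)"
proof -
  define q where "q = p / (p - 1)"
  define U where "U = (\<Sum>i\<in>I. u i * \<bar>x i\<bar> powr p)"
  define V where "V = (\<Sum>j\<in>J. v j * \<bar>y j\<bar> powr q)"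
  have U0: "U \<ge> 0" unfolding U_def by (intro sum_nonneg mult_nonneg_nonneg u) auto
  have V0: "V \<ge> 0" unfolding V_def by (intro sum_nonneg mult_nonneg_nonneg v) auto
  have q0: "q > 0" and q1: "q * (1 - 1 / p) = 1" using p by (auto simp: q_def field_simps)
  \<comment> \<open>For \<open>p = 2\<close> the point \<open>2 / p\<close> lies on the edge of the
    strip, which \<open>three_lines\<close> excludes; there the claim is the hypothesis
    \<open>L2\<close>.\<close>
  consider "p = 2" | "p > 2" using p by linarith
  then have "\<bar>\<Sum>i\<in>I. \<Sum>j\<in>J. c i j * x i * y j\<bar>
      \<le> K powr (1 - 2 / p) * r powr (2 / p) * U powr (1 / p) * V powr (1 - 1 / p)"
  proof cases
    case 1
    then have "q = 2" by (simp add: q_def)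
    then show ?thesis using L2[of x y] U0 V0 r K 1 unfolding U_def V_def
      by (simp add: powr_half_sqrt powr_numeral)
  next
    case 2
    \<comment> \<open>The line \<open>Re z = 0\<close> carries the exponents \<open>(\<infinity>, 1)\<close>, the line \<open>Re z = 1\<close> the exponents
      \<open>(2, 2)\<close>, and \<open>z = 2 / p\<close> recovers \<open>x\<close> and \<open>y\<close>. Zero entries are harmless because \<open>sgn 0 = 0\<close>.\<close>
    define X where "X = (\<lambda>(z::complex) i. of_real (sgn (x i)) * exp (z * of_real (p / 2 * ln \<bar>x i\<bar>)))"
    define Y where "Y = (\<lambda>(z::complex) j. of_real (sgn (y j)) * exp ((1 - z / 2) * of_real (q * ln \<bar>y j\<bar>)))"
    have nX: "norm (X z i) = (if x i = 0 then 0 else \<bar>x i\<bar> powr (Re z * (p / 2)))" for z i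
      by (simp add: X_def norm_mult powr_def abs_sgn_eq mult_ac)
    have nY: "norm (Y z j) = \<bar>y j\<bar> powr ((1 - Re z / 2) * q)" for z j
      by (simp add: Y_def norm_mult powr_def abs_sgn_eq mult_ac)
    have sgn_exp: "of_real (sgn a) * exp (of_real (ln \<bar>a\<bar>)) = complex_of_real a" for a :: real
    proof (cases "a = 0")
      case False
      then have "sgn a * exp (ln \<bar>a\<bar>) = a" by (simp add: sgn_mult_abs)
      then show ?thesis by (metis exp_of_real of_real_mult)
    qed simp
    have X_t: "X (of_real (2 / p)) i = of_real (x i)" for i
    proof -
      have "2 / p * (p / 2 * ln \<bar>x i\<bar>) = ln \<bar>x i\<bar>" using 2 by simp
      then show ?thesis unfolding X_def by (simp only: of_real_mult[symmetric] sgn_exp)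
    qed
    have Y_t: "Y (of_real (2 / p)) j = of_real (y j)" for j
    proof -
      have "(1 - 2 / p / 2) * (q * ln \<bar>y j\<bar>) = q * (1 - 1 / p) * ln \<bar>y j\<bar>" by simp
      then have "(1 - 2 / p / 2) * (q * ln \<bar>y j\<bar>) = ln \<bar>y j\<bar>" unfolding q1 by simp
      moreover have "1 - complex_of_real (2 / p) / 2 = of_real (1 - 2 / p / 2)" by simp
      ultimately show ?thesis unfolding Y_def by (simp only: of_real_mult[symmetric] sgn_exp)
    qed
    define \<Phi> where "\<Phi> = (\<lambda>z. \<Sum>i\<in>I. \<Sum>j\<in>J. of_real (c i j) * X z i * Y z j)"
    have "norm (\<Phi> (of_real (2 / p))) \<le> (K * V) powr (1 - 2 / p) * (r * (sqrt U * sqrt V)) powr (2 / p)"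
    proof (rule three_lines)
      show "\<Phi> holomorphic_on UNIV" unfolding \<Phi>_def X_def Y_def by (intro holomorphic_intros) auto
      show "0 < 2 / p" "2 / p < 1" using 2 by auto
    next
      fix z assume z: "0 \<le> Re z" "Re z \<le> 1"
      \<comment> \<open>Some bound on the whole strip is required, of any size. The exponents of
        \<open>\<bar>x i\<bar>\<close> and \<open>\<bar>y j\<bar>\<close> stay within
        \<open>[0, p / 2]\<close> and \<open>[0, q]\<close> there.\<close>
      have lnb: "a powr b \<le> exp (B * \<bar>ln a\<bar>)" if "0 \<le> b" "b \<le> B" for a b B :: real
      proof -
        have "b * ln a \<le> b * \<bar>ln a\<bar>" using that by (intro mult_left_mono) auto
        also have "\<dots> \<le> B * \<bar>ln a\<bar>" using that by (intro mult_right_mono) auto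
        finally show ?thesis by (simp add: powr_def)
      qed
      have bX: "norm (X z i) \<le> exp (p / 2 * \<bar>ln \<bar>x i\<bar>\<bar>)" for i
        unfolding nX using lnb[of "Re z * (p / 2)" "p / 2" "\<bar>x i\<bar>"] z 2
        by (auto simp: mult_left_le_one_le)
      have bY: "norm (Y z j) \<le> exp (q * \<bar>ln \<bar>y j\<bar>\<bar>)" for j
        unfolding nY using lnb[of "(1 - Re z / 2) * q" q "\<bar>y j\<bar>"] z q0
        by (auto simp: mult_left_le_one_le)
      show "norm (\<Phi> z) \<le> (\<Sum>i\<in>I. \<Sum>j\<in>J. \<bar>c i j\<bar> * exp (p / 2 * \<bar>ln \<bar>x i\<bar>\<bar>) * exp (q * \<bar>ln \<bar>y j\<bar>\<bar>))"
        unfolding \<Phi>_def by (intro sum_norm_le)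
          (auto simp only: norm_mult norm_of_real intro!: sum_norm_le mult_mono bX bY mult_nonneg_nonneg norm_ge_zero exp_ge_zero abs_ge_zero)
    next
      fix z assume z: "Re z = 0"
      \<comment> \<open>On this edge the entries of \<open>X z\<close> have modulus at most 1 and
        those of \<open>Y z\<close> have modulus \<open>\<bar>y j\<bar> powr q\<close>, so summing
        over \<open>i\<close> first leaves the column sums of \<open>L1\<close>.\<close>
      have "norm (\<Phi> z) \<le> (\<Sum>i\<in>I. \<Sum>j\<in>J. \<bar>c i j\<bar> * \<bar>y j\<bar> powr q)"
        unfolding \<Phi>_def by (intro sum_norm_le) (auto simp: norm_mult nX nY z intro!: sum_nonneg)
      also have "\<dots> = (\<Sum>j\<in>J. (\<Sum>i\<in>I. \<bar>c i j\<bar>) * \<bar>y j\<bar> powr q)"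
        by (subst sum.swap) (simp add: sum_distrib_right)
      also have "\<dots> \<le> (\<Sum>j\<in>J. K * v j * \<bar>y j\<bar> powr q)"
        by (intro sum_mono mult_right_mono L1) auto
      finally show "norm (\<Phi> z) \<le> K * V" by (simp add: V_def sum_distrib_left mult_ac)
    next
      fix z assume z: "Re z = 1"
      have "(norm (X z i))\<^sup>2 = \<bar>x i\<bar> powr p" for i
        using 2 by (simp add: nX z power2_eq_square flip: powr_add)
      moreover have "(norm (Y z j))\<^sup>2 = \<bar>y j\<bar> powr q" for j
        by (simp add: nY z power2_eq_square flip: powr_add)
      ultimately show "norm (\<Phi> z) \<le> r * (sqrt U * sqrt V)"
        using bilinear_bound_complexify[of I u J v r c "X z" "Y z", OF u v r L2]
        unfolding \<Phi>_def U_def V_def by simp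
    qed
    also have "\<Phi> (of_real (2 / p)) = of_real (\<Sum>i\<in>I. \<Sum>j\<in>J. c i j * x i * y j)"
      unfolding \<Phi>_def X_t Y_t by simp
    \<comment> \<open>\<open>U\<close> enters only through the right edge, as
      \<open>sqrt U powr (2 / p)\<close>. \<open>V\<close> collects the exponent
      \<open>1 - 2 / p\<close> from the left edge and \<open>1 / p\<close> from the right
      edge.\<close>
    also have "(K * V) powr (1 - 2 / p) * (r * (sqrt U * sqrt V)) powr (2 / p)
        = K powr (1 - 2 / p) * r powr (2 / p) * U powr (1 / p) * (V powr (1 - 2 / p) * V powr (1 / p))"
      using K r U0 V0 2 by (simp add: powr_mult powr_powr flip: powr_half_sqrt)
    also have "V powr (1 - 2 / p) * V powr (1 / p) = V powr (1 - 1 / p)"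
      by (simp flip: powr_add)
    finally show ?thesis by (simp only: norm_of_real)
  qed
  then show ?thesis unfolding U_def V_def q_def .
qed

subsection \<open>Interpolation of covariances and conditional expectations\<close>

context prob_space begin

lemma simple_level_measurable:
  assumes "simple_function M f"
  shows "{x\<in>space M. f x = a} \<in> sets M"
  using simple_functionD(2)[OF assms, of "{a}"] by (simp add: vimage_def Int_def conj_commute)

text \<open>Passing to the joint law of two simple functions turns covariances into finite bilinear
  forms.\<close>

lemma integral_simple_pair:
  fixes f g :: "'a \<Rightarrow> real" and H :: "real \<Rightarrow> real \<Rightarrow> real"
  assumes f: "simple_function M f" and g: "simple_function M g"
  shows "(\<integral>x. H (f x) (g x) \<partial>M) =
    (\<Sum>a\<in>f ` space M. \<Sum>b\<in>g ` space M. H a b * prob {x\<in>space M. f x = a \<and> g x = b})"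
proof -
  have fin: "finite (f ` space M)" "finite (g ` space M)"
    using f g by (auto simp: simple_function_def)
  have meas: "{x\<in>space M. f x = a \<and> g x = b} \<in> sets M" for a b
    using sets.Int[OF simple_level_measurable[OF f, of a] simple_level_measurable[OF g, of b]]
    by (simp add: Collect_conj_eq[symmetric] Int_def conj_ac)
  have "H (f x) (g x) = (\<Sum>a\<in>f ` space M. \<Sum>b\<in>g ` space M.
      H a b * indicator {x\<in>space M. f x = a \<and> g x = b} x)" if x: "x \<in> space M" for x
  proof -
    have "(\<Sum>a\<in>f ` space M. \<Sum>b\<in>g ` space M. H a b * indicator {x\<in>space M. f x = a \<and> g x = b} x)
      = (\<Sum>a\<in>f ` space M. if f x = a then \<Sum>b\<in>g ` space M. if g x = b then H a b else 0 else 0)"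
      using x by (intro sum.cong) (auto simp: indicator_def intro!: sum.cong)
    also have "\<dots> = H (f x) (g x)" using x fin by (simp add: sum.delta')
    finally show ?thesis by simp
  qed
  then have "(\<integral>x. H (f x) (g x) \<partial>M) = (\<integral>x. (\<Sum>a\<in>f ` space M. \<Sum>b\<in>g ` space M.
      H a b * indicator {x\<in>space M. f x = a \<and> g x = b} x) \<partial>M)"
    by (intro Bochner_Integration.integral_cong) auto
  also have "\<dots> = (\<Sum>a\<in>f ` space M. \<Sum>b\<in>g ` space M. H a b * prob {x\<in>space M. f x = a \<and> g x = b})"
    using meas by (simp add: emeasure_finite less_top[symmetric])
  finally show ?thesis .
qed

lemma integral_simple_compose:
  fixes f :: "'a \<Rightarrow> real" and h :: "real \<Rightarrow> real"
  assumes f: "simple_function M f"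
  shows "(\<integral>x. h (f x) \<partial>M) = (\<Sum>a\<in>f ` space M. h a * prob {x\<in>space M. f x = a})"
  using integral_simple_pair[OF f simple_function_const[of M 0], of "\<lambda>a b. h a"] not_empty
  by (simp add: image_constant_conv)

lemma simple_integrable:
  fixes f :: "'a \<Rightarrow> real"
  assumes f: "simple_function M f"
  shows "integrable M f"
proof (rule integrable_const_bound)
  show "AE x in M. norm (f x) \<le> Max ((\<lambda>x. norm (f x)) ` space M)"
    using finite_imageI[of "f ` space M" norm] f
    by (intro AE_I2 Max_ge) (auto simp: simple_function_def image_image)
qed (rule borel_measurable_simple_function[OF f])

lemma subalgebra_simple_function:
  assumes "subalgebra M A" "simple_function A f"
  shows "simple_function M f"
  using assms unfolding simple_function_def subalgebra_def by auto

text \<open>With finitely many values, \<open>h\<close> composed with \<open>f\<close> is again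
  simple for every \<open>h\<close>; hence arbitrary coefficients on the values of \<open>f\<close>
  give admissible test functions.\<close>

lemma subalgebra_simple_L2:
  assumes "subalgebra M A" "simple_function A f"
  shows "(\<lambda>x. h (f x)) \<in> L2_space M A"
proof -
  have "simple_function A (\<lambda>x. h (f x))"
    using simple_function_compose1[OF assms(2), of h] by simp
  moreover have "simple_function M (\<lambda>x. (h (f x))\<^sup>2)"
    using simple_function_compose1[OF subalgebra_simple_function[OF assms], of "\<lambda>t. (h t)\<^sup>2"] by simp
  ultimately show ?thesis unfolding L2_space_def
    by (auto intro: borel_measurable_simple_function simple_integrable)
qed

text \<open>On simple functions the covariance is the bilinear form whose matrix is the joint law
  minus the product of the marginals. \<open>finite_riesz_thorin\<close> applies to it with
  \<open>K = 2\<close>.\<close>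

lemma cov_interpolation_simple:
  fixes f g :: "'a \<Rightarrow> real"
  assumes A: "subalgebra M A" and B: "subalgebra M B"
    and r: "0 \<le> r" and p: "2 \<le> p"
    and cov: "\<And>g f. g \<in> L2_space M A \<Longrightarrow> f \<in> L2_space M B \<Longrightarrow>
      \<bar>(\<integral>x. g x * f x \<partial>M) - (\<integral>x. g x \<partial>M) * (\<integral>x. f x \<partial>M)\<bar>
        \<le> r * (sqrt (\<integral>x. (g x)\<^sup>2 \<partial>M) * sqrt (\<integral>x. (f x)\<^sup>2 \<partial>M))"
    and g: "simple_function A g" and f: "simple_function B f"
  shows "\<bar>(\<integral>x. g x * f x \<partial>M) - (\<integral>x. g x \<partial>M) * (\<integral>x. f x \<partial>M)\<bar>
    \<le> 2 powr (1 - 2 / p) * r powr (2 / p) * (\<integral>x. \<bar>f x\<bar> powr p \<partial>M) powr (1 / p)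
        * (\<integral>x. \<bar>g x\<bar> powr (p / (p - 1)) \<partial>M) powr (1 - 1 / p)"
proof -
  have f': "simple_function M f" using B f by (rule subalgebra_simple_function)
  have g': "simple_function M g" using A g by (rule subalgebra_simple_function)
  have fin: "finite (f ` space M)" "finite (g ` space M)"
    using f' g' by (auto simp: simple_function_def)
  have mf: "{x\<in>space M. f x = a} \<in> sets M" for a using f' by (rule simple_level_measurable)
  have mg: "{x\<in>space M. g x = a} \<in> sets M" for a using g' by (rule simple_level_measurable)
  have mfg: "{x\<in>space M. f x = a \<and> g x = b} \<in> sets M" for a b
    using sets.Int[OF mf[of a] mg[of b]] by (simp add: Collect_conj_eq[symmetric] Int_def conj_ac)
  define u where "u = (\<lambda>a. prob {x\<in>space M. f x = a})"
  define v where "v = (\<lambda>b. prob {x\<in>space M. g x = b})"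
  define c where "c = (\<lambda>a b. prob {x\<in>space M. f x = a \<and> g x = b} - u a * v b)"
  have Ef: "(\<integral>x. h (f x) \<partial>M) = (\<Sum>a\<in>f ` space M. u a * h a)" for h
    using integral_simple_compose[OF f', of h] by (simp add: u_def mult.commute)
  have Eg: "(\<integral>x. h (g x) \<partial>M) = (\<Sum>b\<in>g ` space M. v b * h b)" for h
    using integral_simple_compose[OF g', of h] by (simp add: v_def mult.commute)
  have C: "(\<integral>x. k (g x) * h (f x) \<partial>M) - (\<integral>x. k (g x) \<partial>M) * (\<integral>x. h (f x) \<partial>M)
      = (\<Sum>a\<in>f ` space M. \<Sum>b\<in>g ` space M. c a b * h a * k b)" for h k
  proof -
    have "(\<integral>x. k (g x) * h (f x) \<partial>M) = (\<Sum>a\<in>f ` space M. \<Sum>b\<in>g ` space M.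
        k b * h a * prob {x\<in>space M. f x = a \<and> g x = b})"
      by (rule integral_simple_pair[OF f' g'])
    moreover have "(\<integral>x. k (g x) \<partial>M) * (\<integral>x. h (f x) \<partial>M)
        = (\<Sum>a\<in>f ` space M. \<Sum>b\<in>g ` space M. u a * h a * (v b * k b))"
      unfolding Ef Eg sum_product by (subst sum.swap) (simp add: mult_ac)
    ultimately show ?thesis
      by (simp add: c_def algebra_simps sum_subtractf)
  qed
  have colsum: "(\<Sum>a\<in>f ` space M. prob {x\<in>space M. f x = a \<and> g x = b}) = v b" for b
  proof -
    have "(\<Sum>a\<in>f ` space M. prob {x\<in>space M. f x = a \<and> g x = b})
        = prob (\<Union>a\<in>f ` space M. {x\<in>space M. f x = a \<and> g x = b})"
      by (intro finite_measure_finite_Union[symmetric]) (auto simp: fin mfg disjoint_family_on_def)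
    also have "(\<Union>a\<in>f ` space M. {x\<in>space M. f x = a \<and> g x = b}) = {x\<in>space M. g x = b}" by auto
    finally show ?thesis by (simp add: v_def)
  qed
  have usum: "(\<Sum>a\<in>f ` space M. u a) = 1" using Ef[of "\<lambda>_. 1"] by (simp add: prob_space)
  have "\<bar>\<Sum>a\<in>f ` space M. \<Sum>b\<in>g ` space M. c a b * a * b\<bar>
      \<le> 2 powr (1 - 2 / p) * r powr (2 / p) * (\<Sum>a\<in>f ` space M. u a * \<bar>a\<bar> powr p) powr (1 / p)
        * (\<Sum>b\<in>g ` space M. v b * \<bar>b\<bar> powr (p / (p - 1))) powr (1 - 1 / p)"
  proof (rule finite_riesz_thorin)
    fix h k :: "real \<Rightarrow> real"
    \<comment> \<open>Coefficient vectors \<open>h\<close> and \<open>k\<close> correspond to the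
      random variables \<open>h (f x)\<close> and \<open>k (g x)\<close>, so the covariance
      hypothesis is the required \<open>L_2\<close> bound on the matrix.\<close>
    have "\<bar>(\<integral>x. k (g x) * h (f x) \<partial>M) - (\<integral>x. k (g x) \<partial>M) * (\<integral>x. h (f x) \<partial>M)\<bar>
        \<le> r * (sqrt (\<integral>x. (k (g x))\<^sup>2 \<partial>M) * sqrt (\<integral>x. (h (f x))\<^sup>2 \<partial>M))"
      by (intro cov subalgebra_simple_L2 A B f g)
    then show "\<bar>\<Sum>a\<in>f ` space M. \<Sum>b\<in>g ` space M. c a b * h a * k b\<bar>
      \<le> r * (sqrt (\<Sum>a\<in>f ` space M. u a * (h a)\<^sup>2) * sqrt (\<Sum>b\<in>g ` space M. v b * (k b)\<^sup>2))"
      unfolding C Ef[of "\<lambda>t. (h t)\<^sup>2"] Eg[of "\<lambda>t. (k t)\<^sup>2"] by (simp only: mult.commute mult.left_commute)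
  next
    fix b
    \<comment> \<open>Joint law and product law each have column sum \<open>v b\<close>. The
      resulting 2 is the norm on bounded functions and the source of
      \<open>2 powr (1 - 2 / p)\<close>.\<close>
    have "(\<Sum>a\<in>f ` space M. \<bar>c a b\<bar>)
        \<le> (\<Sum>a\<in>f ` space M. prob {x\<in>space M. f x = a \<and> g x = b} + u a * v b)"
      unfolding c_def by (intro sum_mono order_trans[OF abs_triangle_ineq4])
        (simp add: u_def v_def)
    also have "\<dots> = 2 * v b"
      by (simp add: sum.distrib colsum usum flip: sum_distrib_right)
    finally show "(\<Sum>a\<in>f ` space M. \<bar>c a b\<bar>) \<le> 2 * v b" .
  qed (use fin r p in \<open>auto simp: u_def v_def\<close>)
  then show ?thesis
    using C[of "\<lambda>b. b" "\<lambda>a. a"] Ef[of "\<lambda>a. \<bar>a\<bar> powr p"] Eg[of "\<lambda>b. \<bar>b\<bar> powr (p / (p - 1))"] by simp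
qed

end

section \<open>Passage from simple functions to \<open>L_p\<close>\<close>

lemma abs_le_one_plus_powr: "\<bar>x\<bar> \<le> 1 + \<bar>x\<bar> powr p" if "1 \<le> p" for x p :: real
proof (cases "\<bar>x\<bar> \<le> 1")
  case False
  then have "\<bar>x\<bar> powr 1 \<le> \<bar>x\<bar> powr p" using that by (intro powr_mono) auto
  then show ?thesis by simp
qed (simp add: add_increasing2)

lemma mult_le_powr_conjugate:
  fixes x y p :: real
  assumes p: "1 < p"
  shows "\<bar>x * y\<bar> \<le> \<bar>x\<bar> powr p + \<bar>y\<bar> powr (p / (p - 1))"
proof -
  have "\<bar>x\<bar> * \<bar>y\<bar> \<le> \<bar>x\<bar> powr p / p + \<bar>y\<bar> powr (p / (p - 1)) / (p / (p - 1))"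
    using p by (intro Youngs_inequality) (auto simp: field_simps)
  also have "\<dots> \<le> \<bar>x\<bar> powr p + \<bar>y\<bar> powr (p / (p - 1))"
    using p by (intro add_mono) (auto simp: divide_le_eq mult_le_cancel_left1 intro!: mult_left_mono)
  finally show ?thesis by (simp add: abs_mult)
qed

context prob_space begin

lemma integrable_of_powr:
  assumes "1 \<le> p" "f \<in> borel_measurable M" "integrable M (\<lambda>x. \<bar>f x :: real\<bar> powr p)"
  shows "integrable M f"
proof (rule Bochner_Integration.integrable_bound)
  show "integrable M (\<lambda>x. 1 + \<bar>f x\<bar> powr p)" using assms by auto
  show "AE x in M. norm (f x) \<le> norm (1 + \<bar>f x\<bar> powr p)"
    using abs_le_one_plus_powr[OF assms(1)] by (intro AE_I2) (auto simp: abs_of_nonneg)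
qed fact

text \<open>The bound \<open>2 * \<bar>f x\<bar>\<close> is the one that the simple approximations
  with reference point 0 satisfy.\<close>

lemma dominated_convergence_abs_powr:
  fixes f :: "'a \<Rightarrow> real"
  assumes p: "0 < p" and f: "f \<in> borel_measurable M" "integrable M (\<lambda>x. \<bar>f x\<bar> powr p)"
    and s: "\<And>i. s i \<in> borel_measurable M"
    and lim: "\<And>x. x \<in> space M \<Longrightarrow> (\<lambda>i. s i x) \<longlonglongrightarrow> f x"
    and bound: "\<And>i x. x \<in> space M \<Longrightarrow> \<bar>s i x\<bar> \<le> 2 * \<bar>f x\<bar>"
  shows "(\<lambda>i. \<integral>x. \<bar>s i x\<bar> powr p \<partial>M) \<longlonglongrightarrow> (\<integral>x. \<bar>f x\<bar> powr p \<partial>M)"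
proof (rule integral_dominated_convergence)
  show "integrable M (\<lambda>x. 2 powr p * \<bar>f x\<bar> powr p)" using f by simp
  show "AE x in M. (\<lambda>i. \<bar>s i x\<bar> powr p) \<longlonglongrightarrow> \<bar>f x\<bar> powr p"
    using p by (intro AE_I2 tendsto_powr' tendsto_intros lim) auto
  show "AE x in M. norm (\<bar>s i x\<bar> powr p) \<le> 2 powr p * \<bar>f x\<bar> powr p" for i
  proof (rule AE_I2)
    fix x assume x: "x \<in> space M"
    have "\<bar>s i x\<bar> powr p \<le> (2 * \<bar>f x\<bar>) powr p"
      using bound[OF x, of i] p by (intro powr_mono2) auto
    then show "norm (\<bar>s i x\<bar> powr p) \<le> 2 powr p * \<bar>f x\<bar> powr p" by (simp add: powr_mult)
  qed
qed (use f s in auto)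

text \<open>Both sides pass to the limit along simple approximations by dominated convergence; the
  products are dominated through Young's inequality for the conjugate exponents.\<close>

lemma cov_interpolation:
  fixes f g :: "'a \<Rightarrow> real"
  assumes A: "subalgebra M A" and B: "subalgebra M B"
    and r: "0 \<le> r" and p: "2 \<le> p"
    and cov: "\<And>g f. g \<in> L2_space M A \<Longrightarrow> f \<in> L2_space M B \<Longrightarrow>
      \<bar>(\<integral>x. g x * f x \<partial>M) - (\<integral>x. g x \<partial>M) * (\<integral>x. f x \<partial>M)\<bar>
        \<le> r * (sqrt (\<integral>x. (g x)\<^sup>2 \<partial>M) * sqrt (\<integral>x. (f x)\<^sup>2 \<partial>M))"
    and g: "g \<in> borel_measurable A" "integrable M (\<lambda>x. \<bar>g x\<bar> powr (p / (p - 1)))"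
    and f: "f \<in> borel_measurable B" "integrable M (\<lambda>x. \<bar>f x\<bar> powr p)"
  shows "\<bar>(\<integral>x. g x * f x \<partial>M) - (\<integral>x. g x \<partial>M) * (\<integral>x. f x \<partial>M)\<bar>
    \<le> 2 powr (1 - 2 / p) * r powr (2 / p) * (\<integral>x. \<bar>f x\<bar> powr p \<partial>M) powr (1 / p)
        * (\<integral>x. \<bar>g x\<bar> powr (p / (p - 1)) \<partial>M) powr (1 - 1 / p)"
proof -
  define q where "q = p / (p - 1)"
  have q: "1 \<le> q" using p by (simp add: q_def)
  have mf: "f \<in> borel_measurable M" using measurable_from_subalg[OF B f(1)] .
  have mg: "g \<in> borel_measurable M" using measurable_from_subalg[OF A g(1)] .
  have If: "integrable M f" using p by (intro integrable_of_powr[OF _ mf f(2)]) auto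
  have Ig: "integrable M g" using q g(2) by (intro integrable_of_powr[OF _ mg, of q]) (auto simp: q_def)
  have spA: "space A = space M" and spB: "space B = space M" using A B by (auto simp: subalgebra_def)
  \<comment> \<open>The approximants are simple for \<open>A\<close> and \<open>B\<close>
    themselves, not only for \<open>M\<close>, so that \<open>cov_interpolation_simple\<close>
    covers them.\<close>
  obtain s where s: "\<And>i. simple_function A (s i)" "\<And>x. x \<in> space M \<Longrightarrow> (\<lambda>i. s i x) \<longlonglongrightarrow> g x"
    "\<And>i x. x \<in> space M \<Longrightarrow> \<bar>s i x\<bar> \<le> 2 * \<bar>g x\<bar>"
    using borel_measurable_implies_sequence_metric[OF g(1), of 0] unfolding spA by simp metis
  obtain t where t: "\<And>i. simple_function B (t i)" "\<And>x. x \<in> space M \<Longrightarrow> (\<lambda>i. t i x) \<longlonglongrightarrow> f x"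
    "\<And>i x. x \<in> space M \<Longrightarrow> \<bar>t i x\<bar> \<le> 2 * \<bar>f x\<bar>"
    using borel_measurable_implies_sequence_metric[OF f(1), of 0] unfolding spB by simp metis
  have ms: "s i \<in> borel_measurable M" for i
    using subalgebra_simple_function[OF A s(1)] by (rule borel_measurable_simple_function)
  have mt: "t i \<in> borel_measurable M" for i
    using subalgebra_simple_function[OF B t(1)] by (rule borel_measurable_simple_function)
  have Lg: "(\<lambda>i. \<integral>x. s i x \<partial>M) \<longlonglongrightarrow> (\<integral>x. g x \<partial>M)"
    by (rule integral_dominated_convergence[where w = "\<lambda>x. 2 * \<bar>g x\<bar>"])
      (use mg ms Ig s in auto)
  have Lf: "(\<lambda>i. \<integral>x. t i x \<partial>M) \<longlonglongrightarrow> (\<integral>x. f x \<partial>M)"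
    by (rule integral_dominated_convergence[where w = "\<lambda>x. 2 * \<bar>f x\<bar>"])
      (use mf mt If t in auto)
  have Lgf: "(\<lambda>i. \<integral>x. s i x * t i x \<partial>M) \<longlonglongrightarrow> (\<integral>x. g x * f x \<partial>M)"
  proof (rule integral_dominated_convergence[where w = "\<lambda>x. 4 * (\<bar>f x\<bar> powr p + \<bar>g x\<bar> powr q)"])
    show "integrable M (\<lambda>x. 4 * (\<bar>f x\<bar> powr p + \<bar>g x\<bar> powr q))" using f(2) g(2) by (simp add: q_def)
    show "AE x in M. norm (s i x * t i x) \<le> 4 * (\<bar>f x\<bar> powr p + \<bar>g x\<bar> powr q)" for i
    proof (rule AE_I2)
      fix x assume x: "x \<in> space M"
      have "\<bar>s i x\<bar> * \<bar>t i x\<bar> \<le> (2 * \<bar>g x\<bar>) * (2 * \<bar>f x\<bar>)"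
        using s(3)[OF x] t(3)[OF x] by (intro mult_mono) auto
      also have "\<dots> = 4 * \<bar>f x * g x\<bar>" by (simp add: abs_mult)
      also have "\<bar>f x * g x\<bar> \<le> \<bar>f x\<bar> powr p + \<bar>g x\<bar> powr q"
        unfolding q_def using p by (intro mult_le_powr_conjugate) auto
      finally show "norm (s i x * t i x) \<le> 4 * (\<bar>f x\<bar> powr p + \<bar>g x\<bar> powr q)"
        by (simp add: abs_mult)
    qed
    show "AE x in M. (\<lambda>i. s i x * t i x) \<longlonglongrightarrow> g x * f x"
      by (intro AE_I2 tendsto_mult s t)
  qed (use mf mg ms mt in auto)
  have Pf: "(\<lambda>i. \<integral>x. \<bar>t i x\<bar> powr p \<partial>M) \<longlonglongrightarrow> (\<integral>x. \<bar>f x\<bar> powr p \<partial>M)"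
    using p by (intro dominated_convergence_abs_powr mf f mt t) auto
  have Pg: "(\<lambda>i. \<integral>x. \<bar>s i x\<bar> powr q \<partial>M) \<longlonglongrightarrow> (\<integral>x. \<bar>g x\<bar> powr q \<partial>M)"
    using q g(2) by (intro dominated_convergence_abs_powr mg ms s) (auto simp: q_def)
  have p0: "1 / p > 0" "1 - 1 / p > 0" using p by auto
  have "(\<lambda>i. \<bar>(\<integral>x. s i x * t i x \<partial>M) - (\<integral>x. s i x \<partial>M) * (\<integral>x. t i x \<partial>M)\<bar>) \<longlonglongrightarrow>
      \<bar>(\<integral>x. g x * f x \<partial>M) - (\<integral>x. g x \<partial>M) * (\<integral>x. f x \<partial>M)\<bar>"
    by (intro tendsto_intros Lgf Lg Lf)
  moreover have "(\<lambda>i. 2 powr (1 - 2 / p) * r powr (2 / p) * (\<integral>x. \<bar>t i x\<bar> powr p \<partial>M) powr (1 / p)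
        * (\<integral>x. \<bar>s i x\<bar> powr q \<partial>M) powr (1 - 1 / p)) \<longlonglongrightarrow>
      2 powr (1 - 2 / p) * r powr (2 / p) * (\<integral>x. \<bar>f x\<bar> powr p \<partial>M) powr (1 / p)
        * (\<integral>x. \<bar>g x\<bar> powr q \<partial>M) powr (1 - 1 / p)"
    \<comment> \<open>Positive exponents \<open>1 / p\<close> and \<open>1 - 1 / p\<close> give
      continuity of the powers even if a limiting moment is 0.\<close>
    using p0 by (intro tendsto_mult[OF tendsto_mult[OF tendsto_const]] tendsto_powr' Pf Pg tendsto_const)
      (auto intro!: always_eventually integral_nonneg_AE)
  ultimately have "\<bar>(\<integral>x. g x * f x \<partial>M) - (\<integral>x. g x \<partial>M) * (\<integral>x. f x \<partial>M)\<bar>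
    \<le> 2 powr (1 - 2 / p) * r powr (2 / p) * (\<integral>x. \<bar>f x\<bar> powr p \<partial>M) powr (1 / p)
        * (\<integral>x. \<bar>g x\<bar> powr q \<partial>M) powr (1 - 1 / p)"
    by (rule LIMSEQ_le) (use cov_interpolation_simple[OF A B r p cov s(1) t(1)] in \<open>auto simp: q_def\<close>)
  then show ?thesis by (simp add: q_def)
qed

end

section \<open>Convexity of powers and moments of conditional expectations\<close>

lemma convex_on_abs_powr:
  fixes p :: real
  assumes p: "1 \<le> p"
  shows "convex_on UNIV (\<lambda>x::real. \<bar>x\<bar> powr p)"
proof (rule convex_onI)
  fix t x y :: real
  assume t: "0 < t" "t < 1"
  \<comment> \<open>Handles a vanishing argument: \<open>s powr p <= s\<close> for
    \<open>0 < s < 1\<close> and \<open>p >= 1\<close>.\<close>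
  have small: "(s * z) powr p \<le> s * z powr p" if "0 < s" "s < 1" "0 \<le> z" for s z :: real
  proof -
    have "s powr p \<le> s powr 1" using that p by (intro powr_mono') auto
    then show ?thesis using that by (simp add: powr_mult mult_right_mono)
  qed
  have "\<bar>(1 - t) *\<^sub>R x + t *\<^sub>R y\<bar> \<le> (1 - t) * \<bar>x\<bar> + t * \<bar>y\<bar>"
    using abs_triangle_ineq[of "(1 - t) * x" "t * y"] t by (simp add: abs_mult)
  then have "\<bar>(1 - t) *\<^sub>R x + t *\<^sub>R y\<bar> powr p \<le> ((1 - t) * \<bar>x\<bar> + t * \<bar>y\<bar>) powr p"
    using p by (intro powr_mono2) auto
  also have "\<dots> \<le> (1 - t) * \<bar>x\<bar> powr p + t * \<bar>y\<bar> powr p"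
  proof (cases "x = 0 \<or> y = 0")
    case True
    then show ?thesis using small[of t "\<bar>y\<bar>"] small[of "1 - t" "\<bar>x\<bar>"] t p by auto
  next
    case False
    then show ?thesis
      using convex_onD[OF powr_convex[OF p], of t "\<bar>x\<bar>" "\<bar>y\<bar>"] t by simp
  qed
  finally show "\<bar>(1 - t) *\<^sub>R x + t *\<^sub>R y\<bar> powr p \<le> (1 - t) * \<bar>x\<bar> powr p + t * \<bar>y\<bar> powr p" .
qed simp

text \<open>Jensen's inequality for \<open>\<bar>x\<bar> powr p\<close> with probability weights
  \<open>b k / S\<close> at the points \<open>h k * S / b k\<close>, where \<open>S\<close> is the
  sum of the \<open>b k\<close>.\<close>

lemma abs_sum_powr_le_weighted:
  fixes b h :: "'i \<Rightarrow> real" and p :: real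
  assumes p: "1 \<le> p" and K: "finite K" and b: "\<And>k. k \<in> K \<Longrightarrow> 0 < b k"
  shows "\<bar>\<Sum>k\<in>K. h k\<bar> powr p \<le> (\<Sum>k\<in>K. b k) powr (p - 1) * (\<Sum>k\<in>K. b k powr (1 - p) * \<bar>h k\<bar> powr p)"
proof (cases "K = {}")
  case False
  define S where "S = (\<Sum>k\<in>K. b k)"
  have S: "0 < S" unfolding S_def using K False b by (intro sum_pos) auto
  have "\<bar>\<Sum>k\<in>K. (b k / S) *\<^sub>R (h k * S / b k)\<bar> powr p
      \<le> (\<Sum>k\<in>K. b k / S * \<bar>h k * S / b k\<bar> powr p)"
    by (rule convex_on_sum[OF K False convex_on_abs_powr[OF p]])
      (use b S in \<open>auto simp: S_def sum_divide_distrib[symmetric] less_imp_le\<close>)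
  also have "(\<Sum>k\<in>K. (b k / S) *\<^sub>R (h k * S / b k)) = (\<Sum>k\<in>K. h k)"
    using b S by (intro sum.cong) (auto simp: less_imp_neq[symmetric])
  also have "(\<Sum>k\<in>K. b k / S * \<bar>h k * S / b k\<bar> powr p)
      = (\<Sum>k\<in>K. S powr (p - 1) * (b k powr (1 - p) * \<bar>h k\<bar> powr p))"
  proof (rule sum.cong)
    fix k assume k: "k \<in> K"
    have "b k / S * \<bar>h k * S / b k\<bar> powr p = (S powr p / S) * ((b k / b k powr p) * \<bar>h k\<bar> powr p)"
      using b[OF k] S by (simp add: abs_mult powr_mult powr_divide)
    also have "S powr p / S = S powr (p - 1)" using S by (simp add: powr_diff)
    also have "b k / b k powr p = b k powr (1 - p)" using b[OF k] by (simp add: powr_diff)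
    finally show "b k / S * \<bar>h k * S / b k\<bar> powr p = S powr (p - 1) * (b k powr (1 - p) * \<bar>h k\<bar> powr p)" .
  qed simp
  finally show ?thesis by (simp add: S_def sum_distrib_left)
qed simp

context prob_space begin

text \<open>Duality: with \<open>h = E(f | A)\<close>, the extremal test function
  \<open>g = sgn h * \<bar>h\<bar> powr (p - 1)\<close> satisfies
  \<open>\<bar>g\<bar> powr q = g * h = \<bar>h\<bar> powr p\<close>. Its covariance with
  \<open>f\<close> is therefore the \<open>p\<close>-th moment \<open>W\<close> of \<open>h\<close>,
  and interpolation bounds \<open>W\<close> by a multiple of \<open>W powr (1 - 1 / p)\<close>.
  Dividing and raising to the power \<open>p\<close> turns the constant into
  \<open>2 powr (p - 2) * r^2\<close>.\<close>

lemma cond_exp_powr_interpolation: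
  fixes f :: "'a \<Rightarrow> real"
  assumes A: "subalgebra M A" and B: "subalgebra M B"
    and r: "0 \<le> r" and p: "2 \<le> p"
    and cov: "\<And>g f. g \<in> L2_space M A \<Longrightarrow> f \<in> L2_space M B \<Longrightarrow>
      \<bar>(\<integral>x. g x * f x \<partial>M) - (\<integral>x. g x \<partial>M) * (\<integral>x. f x \<partial>M)\<bar>
        \<le> r * (sqrt (\<integral>x. (g x)\<^sup>2 \<partial>M) * sqrt (\<integral>x. (f x)\<^sup>2 \<partial>M))"
    and f: "f \<in> borel_measurable B" "integrable M (\<lambda>x. \<bar>f x\<bar> powr p)"
    and centred: "(\<integral>x. f x \<partial>M) = 0"
  shows "integrable M (\<lambda>x. \<bar>real_cond_exp M A f x\<bar> powr p)"
    and "(\<integral>x. \<bar>real_cond_exp M A f x\<bar> powr p \<partial>M) \<le> 2 powr (p - 2) * r\<^sup>2 * (\<integral>x. \<bar>f x\<bar> powr p \<partial>M)"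
proof -
  interpret finite_measure_subalgebra M A using A by unfold_locales
  define q where "q = p / (p - 1)"
  have mf: "f \<in> borel_measurable M" using measurable_from_subalg[OF B f(1)] .
  have If: "integrable M f" using p by (intro integrable_of_powr[OF _ mf f(2)]) auto
  define h where "h = real_cond_exp M A f"
  have mh: "h \<in> borel_measurable A" by (simp add: h_def)
  have mhM: "h \<in> borel_measurable M" using measurable_from_subalg[OF A mh] .
  \<comment> \<open>Conditional Jensen. This integrability also makes \<open>g\<close> below
    admissible in \<open>cov_interpolation\<close>.\<close>
  show Ih: "integrable M (\<lambda>x. \<bar>real_cond_exp M A f x\<bar> powr p)"
    by (rule integrable_convex_cond_exp[where I = UNIV and q = "\<lambda>x. \<bar>x\<bar> powr p", OF If])
      (use f p in \<open>auto intro!: convex_on_abs_powr\<close>)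
  define g where "g = (\<lambda>x. sgn (h x) * \<bar>h x\<bar> powr (p - 1))"
  have mg: "g \<in> borel_measurable A" unfolding g_def using mh by measurable
  have mgM: "g \<in> borel_measurable M" using measurable_from_subalg[OF A mg] .
  have gq: "\<bar>g x\<bar> powr q = \<bar>h x\<bar> powr p" for x
    using p by (simp add: g_def q_def abs_mult powr_powr abs_sgn_eq)
  have gh: "g x * h x = \<bar>h x\<bar> powr p" for x
  proof -
    have "g x * h x = \<bar>h x\<bar> * \<bar>h x\<bar> powr (p - 1)" by (simp add: g_def sgn_if)
    then show ?thesis by (simp add: powr_mult_base)
  qed
  define W where "W = (\<integral>x. \<bar>h x\<bar> powr p \<partial>M)"
  define Fp where "Fp = (\<integral>x. \<bar>f x\<bar> powr p \<partial>M)"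
  define C where "C = 2 powr (1 - 2 / p) * r powr (2 / p)"
  have W0: "W \<ge> 0" and F0: "Fp \<ge> 0" by (auto simp: W_def Fp_def)
  have "integrable M (\<lambda>x. g x * f x)"
  proof (rule Bochner_Integration.integrable_bound)
    show "integrable M (\<lambda>x. \<bar>f x\<bar> powr p + \<bar>g x\<bar> powr q)"
      unfolding gq using f(2) Ih by (simp add: h_def)
    show "AE x in M. norm (g x * f x) \<le> norm (\<bar>f x\<bar> powr p + \<bar>g x\<bar> powr q)"
      unfolding q_def using mult_le_powr_conjugate[of p "f _" "g _"] p
      by (intro AE_I2) (simp add: mult.commute)
  qed (use mf mgM in auto)
  then have "(\<integral>x. g x * h x \<partial>M) = (\<integral>x. g x * f x \<partial>M)"
    unfolding h_def by (rule real_cond_exp_intg(2)) (use mg mf in auto)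
  \<comment> \<open>\<open>f\<close> is centred, so the subtracted product of means is 0 and a
    covariance appears.\<close>
  then have "W = (\<integral>x. g x * f x \<partial>M) - (\<integral>x. g x \<partial>M) * (\<integral>x. f x \<partial>M)"
    by (simp add: W_def gh centred)
  also have "\<dots> \<le> C * Fp powr (1 / p) * (\<integral>x. \<bar>g x\<bar> powr (p / (p - 1)) \<partial>M) powr (1 - 1 / p)"
    unfolding C_def Fp_def
    using cov_interpolation[OF A B r p cov mg _ f] Ih gq unfolding q_def h_def by auto
  finally have le: "W \<le> C * Fp powr (1 / p) * W powr (1 - 1 / p)"
    using gq unfolding q_def W_def by simp
  have "W \<le> C powr p * Fp"
  proof (cases "W = 0")
    case True
    then show ?thesis using F0 by simp
  next
    case False
    then have W: "W > 0" using W0 by simp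
    have "W powr (1 / p) * W powr (1 - 1 / p) = W" using W by (simp flip: powr_add)
    then have "W powr (1 / p) * W powr (1 - 1 / p) \<le> C * Fp powr (1 / p) * W powr (1 - 1 / p)"
      using le by simp
    then have "W powr (1 / p) \<le> C * Fp powr (1 / p)"
      using W by (subst (asm) mult_le_cancel_right_pos) auto
    then have "(W powr (1 / p)) powr p \<le> (C * Fp powr (1 / p)) powr p"
      using p by (intro powr_mono2) auto
    then show ?thesis using W F0 p by (simp add: powr_powr powr_mult C_def)
  qed
  also have "C powr p = 2 powr (p - 2) * r\<^sup>2"
    using r p by (simp add: C_def powr_mult powr_powr left_diff_distrib)
  finally show "(\<integral>x. \<bar>real_cond_exp M A f x\<bar> powr p \<partial>M) \<le> 2 powr (p - 2) * r\<^sup>2 * (\<integral>x. \<bar>f x\<bar> powr p \<partial>M)"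
    unfolding W_def Fp_def h_def .
qed

section \<open>Covariances and the maximal correlation coefficient\<close>

lemma cauchy_schwarz_integral:
  fixes f g :: "'a \<Rightarrow> real"
  assumes [measurable]: "f \<in> borel_measurable M" "g \<in> borel_measurable M"
    and f: "integrable M (\<lambda>x. (f x)\<^sup>2)" and g: "integrable M (\<lambda>x. (g x)\<^sup>2)"
  shows "integrable M (\<lambda>x. f x * g x)"
    and "\<bar>\<integral>x. f x * g x \<partial>M\<bar> \<le> sqrt (\<integral>x. (f x)\<^sup>2 \<partial>M) * sqrt (\<integral>x. (g x)\<^sup>2 \<partial>M)"
proof -
  show fg: "integrable M (\<lambda>x. f x * g x)"
  proof (rule Bochner_Integration.integrable_bound)
    show "integrable M (\<lambda>x. (f x)\<^sup>2 + (g x)\<^sup>2)" using f g by simp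
    have "\<bar>a * b\<bar> \<le> a\<^sup>2 + b\<^sup>2" for a b :: real
      using sum_squares_bound[of "\<bar>a\<bar>" "\<bar>b\<bar>"] abs_ge_zero[of "a * b"]
      unfolding abs_mult power2_abs by linarith
    then show "AE x in M. norm (f x * g x) \<le> norm ((f x)\<^sup>2 + (g x)\<^sup>2)"
      by (intro AE_I2) auto
  qed simp
  define a b c where "a = (\<integral>x. (f x)\<^sup>2 \<partial>M)" "b = (\<integral>x. (g x)\<^sup>2 \<partial>M)" "c = (\<integral>x. f x * g x \<partial>M)"
  have quad: "0 \<le> s\<^sup>2 * a - 2 * s * t * c + t\<^sup>2 * b" for s t
  proof -
    have "0 \<le> (\<integral>x. (s * f x - t * g x)\<^sup>2 \<partial>M)" by simp
    also have "\<dots> = (\<integral>x. s\<^sup>2 * (f x)\<^sup>2 - 2 * s * t * (f x * g x) + t\<^sup>2 * (g x)\<^sup>2 \<partial>M)"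
      by (simp add: power2_eq_square algebra_simps)
    also have "\<dots> = s\<^sup>2 * a - 2 * s * t * c + t\<^sup>2 * b" using f g fg by (simp add: a_b_c_def)
    finally show ?thesis .
  qed
  have ab: "0 \<le> a" "0 \<le> b" by (auto simp: a_b_c_def)
  have "c\<^sup>2 \<le> a * b"
  proof (cases "b = 0")
    case True
    \<comment> \<open>For \<open>b = 0\<close> the chosen arguments give
      \<open>c^2 * a - c^2 * (a + 1) = - c^2\<close>, which forces \<open>c = 0\<close>.\<close>
    have "0 \<le> - c\<^sup>2" using quad[of c "(a + 1) / 2"] True by (simp add: power2_eq_square algebra_simps)
    then show ?thesis using True by simp
  next
    case False
    have "0 \<le> b * (a * b - c\<^sup>2)" using quad[of b c] by (simp add: power2_eq_square algebra_simps)
    then show ?thesis using False ab by (simp add: zero_le_mult_iff)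
  qed
  then show "\<bar>\<integral>x. f x * g x \<partial>M\<bar> \<le> sqrt (\<integral>x. (f x)\<^sup>2 \<partial>M) * sqrt (\<integral>x. (g x)\<^sup>2 \<partial>M)"
    unfolding a_b_c_def[symmetric] real_sqrt_mult[symmetric] by (simp add: real_le_rsqrt)
qed

text \<open>Cauchy-Schwarz bounds all correlations by 1, so the supremum is a genuine upper bound.
  Multiplying out the denominator bounds the covariance, and centring does not increase second
  moments.\<close>

lemma abs_corr_le_max_corr:
  assumes A: "subalgebra M A" and B: "subalgebra M B"
    and f: "f \<in> L2_space M A" and g: "g \<in> L2_space M B"
  shows "\<bar>corr M f g\<bar> \<le> max_corr M A B"
    and "\<bar>(\<integral>x. f x * g x \<partial>M) - (\<integral>x. f x \<partial>M) * (\<integral>x. g x \<partial>M)\<bar>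
        \<le> max_corr M A B * (sqrt (\<integral>x. (f x)\<^sup>2 \<partial>M) * sqrt (\<integral>x. (g x)\<^sup>2 \<partial>M))"
proof -
  define cen where "cen = (\<lambda>f x. f x - (\<integral>y. f y \<partial>M) :: real)"
  have cen: "cen f \<in> borel_measurable M \<and> integrable M f \<and> integrable M (\<lambda>x. (cen f x)\<^sup>2)
      \<and> (\<integral>x. (cen f x)\<^sup>2 \<partial>M) \<le> (\<integral>x. (f x)\<^sup>2 \<partial>M)"
    if "subalgebra M S" "f \<in> L2_space M S" for f S
  proof -
    have m: "f \<in> borel_measurable M" and i2: "integrable M (\<lambda>x. (f x)\<^sup>2)"
      using that measurable_from_subalg by (auto simp: L2_space_def)
    have i: "integrable M f" using square_integrable_imp_integrable[OF m i2] .
    have eq: "(cen f x)\<^sup>2 = (f x)\<^sup>2 - 2 * (\<integral>y. f y \<partial>M) * f x + (\<integral>y. f y \<partial>M)\<^sup>2" for x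
      by (simp add: cen_def power2_eq_square algebra_simps)
    have "(\<integral>x. (cen f x)\<^sup>2 \<partial>M) = (\<integral>x. (f x)\<^sup>2 \<partial>M) - (\<integral>y. f y \<partial>M)\<^sup>2"
      unfolding eq using i i2 by (simp add: prob_space power2_eq_square)
    then show ?thesis using m i i2 unfolding eq by (auto simp: cen_def)
  qed
  have cs: "\<bar>\<integral>x. cen f x * cen g x \<partial>M\<bar> \<le> sqrt (\<integral>x. (cen f x)\<^sup>2 \<partial>M) * sqrt (\<integral>x. (cen g x)\<^sup>2 \<partial>M)"
    if "f \<in> L2_space M A" "g \<in> L2_space M B" for f g
    using cen[OF A that(1)] cen[OF B that(2)] by (intro cauchy_schwarz_integral) auto
  have corr: "corr M f g = (\<integral>x. cen f x * cen g x \<partial>M) / (sqrt (\<integral>x. (cen f x)\<^sup>2 \<partial>M) * sqrt (\<integral>x. (cen g x)\<^sup>2 \<partial>M))"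
    for f g by (simp add: corr_def cen_def)
  have "\<bar>c / d\<bar> \<le> 1" if "\<bar>c\<bar> \<le> d" for c d :: real
    using that by (cases "d = 0") (auto simp: abs_divide divide_le_eq_1)
  then have "\<bar>corr M f g\<bar> \<le> 1" if "f \<in> L2_space M A" "g \<in> L2_space M B" for f g
    unfolding corr using cs[OF that] .
  then have "bdd_above {\<bar>corr M f g\<bar> | f g. f \<in> L2_space M A \<and> g \<in> L2_space M B}"
    by (intro bdd_aboveI[of _ 1]) auto
  then show le: "\<bar>corr M f g\<bar> \<le> max_corr M A B"
    unfolding max_corr_def using f g by (intro cSup_upper) auto
  then have mc0: "0 \<le> max_corr M A B" by linarith
  define d where "d = sqrt (\<integral>x. (cen f x)\<^sup>2 \<partial>M) * sqrt (\<integral>x. (cen g x)\<^sup>2 \<partial>M)"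
  have d0: "d \<ge> 0" by (simp add: d_def)
  have ig: "integrable M (\<lambda>x. f x * g x)"
    using f g A B measurable_from_subalg by (intro cauchy_schwarz_integral(1)) (auto simp: L2_space_def)
  have "(\<integral>x. cen f x * cen g x \<partial>M)
      = (\<integral>x. f x * g x - (\<integral>y. g y \<partial>M) * f x - (\<integral>y. f y \<partial>M) * g x + (\<integral>y. f y \<partial>M) * (\<integral>y. g y \<partial>M) \<partial>M)"
    by (simp add: cen_def algebra_simps)
  also have "\<dots> = (\<integral>x. f x * g x \<partial>M) - (\<integral>x. f x \<partial>M) * (\<integral>x. g x \<partial>M)"
    using cen[OF A f] cen[OF B g] ig by (simp add: prob_space mult.commute)
  finally have "\<bar>(\<integral>x. f x * g x \<partial>M) - (\<integral>x. f x \<partial>M) * (\<integral>x. g x \<partial>M)\<bar> = \<bar>\<integral>x. cen f x * cen g x \<partial>M\<bar>"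
    by simp
  \<comment> \<open>If \<open>d = 0\<close>, the correlation is 0 only by the convention for
    division and carries no information; the covariance then vanishes by Cauchy-Schwarz.\<close>
  also have "\<dots> \<le> max_corr M A B * d"
  proof (cases "d = 0")
    case True
    then show ?thesis using cs[OF f g] unfolding d_def[symmetric] by simp
  next
    case False
    then show ?thesis using le d0 unfolding corr d_def[symmetric] by (simp add: divide_le_eq)
  qed
  also have "\<dots> \<le> max_corr M A B * (sqrt (\<integral>x. (f x)\<^sup>2 \<partial>M) * sqrt (\<integral>x. (g x)\<^sup>2 \<partial>M))"
    unfolding d_def using cen[OF A f] cen[OF B g] mc0 by (intro mult_left_mono mult_mono) auto
  finally show "\<bar>(\<integral>x. f x * g x \<partial>M) - (\<integral>x. f x \<partial>M) * (\<integral>x. g x \<partial>M)\<bar>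
        \<le> max_corr M A B * (sqrt (\<integral>x. (f x)\<^sup>2 \<partial>M) * sqrt (\<integral>x. (g x)\<^sup>2 \<partial>M))" .
qed

lemma max_corr_nonneg:
  assumes "subalgebra M A" "subalgebra M B"
  shows "0 \<le> max_corr M A B"
  using abs_corr_le_max_corr(1)[OF assms, of "\<lambda>_. 0" "\<lambda>_. 0"] abs_ge_zero order_trans
  by (fastforce simp: L2_space_def)

end

section \<open>The generated sigma-algebras\<close>

lemma subalgebra_generated_sigma:
  assumes "\<And>i. i \<in> I \<Longrightarrow> Y i \<in> borel_measurable M"
  shows "subalgebra M (generated_sigma M Y I)"
  unfolding subalgebra_def generated_sigma_def
  using assms by (subst sets_measure_of) (auto simp: space_measure_of_conv measurable_sets intro!: sets.sigma_sets_subset)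

lemma measurable_generated_sigma:
  assumes "i \<in> I"
  shows "Y i \<in> borel_measurable (generated_sigma M Y I)"
  unfolding generated_sigma_def
proof (rule measurableI)
  let ?G = "\<Union>i\<in>I. {Y i -` B \<inter> space M |B. B \<in> sets borel}"
  fix B :: "real set" assume "B \<in> sets borel"
  then show "Y i -` B \<inter> space (sigma (space M) ?G) \<in> sets (sigma (space M) ?G)"
    using assms by (subst sets_measure_of) (auto simp: space_measure_of_conv)
qed simp

subsection \<open>The bounds for the conditional tails\<close>

text \<open>Young's convolution inequality for two summable sequences: for each fixed
  \<open>k\<close> the shifted sum of \<open>m\<close> is part of the full sum. Extending
  \<open>m\<close> by 0 beyond \<open>n\<close> frees the range of \<open>k\<close> from
  \<open>j\<close>, so the sums can be swapped.\<close>

lemma sum_shifted_product_le: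
  fixes b m :: "nat \<Rightarrow> real"
  assumes b: "\<And>k. 0 \<le> b k" and m: "\<And>i. 0 \<le> m i"
  shows "(\<Sum>j=1..n. \<Sum>k=1..n-j. b k * m (j + k)) \<le> (\<Sum>k=1..n-1. b k) * (\<Sum>i=1..n. m i)"
proof -
  define m' where "m' = (\<lambda>i. if i \<le> n then m i else 0)"
  have "(\<Sum>j=1..n. \<Sum>k=1..n-j. b k * m (j + k)) = (\<Sum>j=1..n. \<Sum>k=1..n-1. b k * m' (j + k))"
    by (intro sum.cong refl sum.mono_neutral_cong_left) (auto simp: m'_def)
  also have "\<dots> = (\<Sum>k=1..n-1. b k * (\<Sum>j=1..n. m' (j + k)))"
    by (subst sum.swap) (simp add: sum_distrib_left)
  also have "\<dots> \<le> (\<Sum>k=1..n-1. b k * (\<Sum>i=1..n. m i))"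
  proof (rule sum_mono, rule mult_left_mono[OF _ b])
    fix k
    have "(\<Sum>j=1..n. m' (j + k)) = (\<Sum>i=1+k..n+k. m' i)"
      by (rule sum.shift_bounds_cl_nat_ivl[symmetric])
    also have "\<dots> = (\<Sum>i=1+k..n. m i)"
      by (intro sum.mono_neutral_cong_right) (auto simp: m'_def)
    also have "\<dots> \<le> (\<Sum>i=1..n. m i)" by (intro sum_mono2 m) auto
    finally show "(\<Sum>j=1..n. m' (j + k)) \<le> (\<Sum>i=1..n. m i)" .
  qed
  finally show ?thesis by (simp add: sum_distrib_right)
qed

text \<open>With \<open>t = \<rho> powr (2 / p)\<close>, the sum is at most
  \<open>1 / (1 - t)\<close> once the term \<open>k = 0\<close> is added. Weighted Young for
  \<open>\<rho>\<close> and 1 bounds \<open>1 - t\<close> below by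
  \<open>2 / p * (1 - \<rho>)\<close>.\<close>

lemma geometric_sum_powr_le:
  fixes p \<rho> :: real
  assumes p: "2 \<le> p" and \<rho>: "0 < \<rho>" "\<rho> < 1"
  shows "(\<Sum>k=1..N. (\<rho> ^ k) powr (2 / p)) \<le> p / (2 * (1 - \<rho>))"
proof -
  define t where "t = \<rho> powr (2 / p)"
  have t: "0 < t" "t < 1" using \<rho> p powr_less_mono2[of "2 / p" \<rho> 1] by (auto simp: t_def)
  have young: "t \<le> 2 / p * \<rho> + (1 - 2 / p)"
    using Youngs_inequality_0[of "2 / p" "1 - 2 / p" \<rho> 1] p \<rho> by (simp add: t_def)
  have "2 / p * (1 - \<rho>) \<le> 1 - t" using young by (simp add: right_diff_distrib)
  have "(\<Sum>k=1..N. (\<rho> ^ k) powr (2 / p)) = (\<Sum>k=1..N. t ^ k)"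
    using \<rho> by (intro sum.cong) (auto simp: t_def powr_powr mult.commute simp flip: powr_realpow)
  also have "\<dots> \<le> (\<Sum>k<Suc N. t ^ k)" using t by (intro sum_mono2) auto
  also have "\<dots> = (1 - t ^ Suc N) / (1 - t)" using t by (subst sum_gp_strict) auto
  also have "\<dots> \<le> 1 / (1 - t)" using t by (intro divide_right_mono) auto
  also have "\<dots> \<le> 1 / (2 / p * (1 - \<rho>))"
    using p \<rho> t \<open>2 / p * (1 - \<rho>) \<le> 1 - t\<close> by (intro divide_left_mono) auto
  also have "\<dots> = p / (2 * (1 - \<rho>))" by simp
  finally show ?thesis .
qed

context prob_space begin

text \<open>The weights \<open>b k\<close> replace \<open>\<rho>\<^sub>k\<^bsup>2/p\<^esup>\<close>, which may vanish, by strictly positive numbers.\<close>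

lemma A_cond_powr_le:
  fixes X :: "nat \<Rightarrow> 'a \<Rightarrow> real" and F :: "nat \<Rightarrow> 'a measure"
  assumes F: "subalgebra M (F j)" and j: "1 \<le> j" "j \<le> n"
    and meas: "\<And>i. 1 \<le> i \<Longrightarrow> i \<le> n \<Longrightarrow> X i \<in> borel_measurable M"
    and compat: "rho_compatible M n F X"
    and p: "2 \<le> p"
    and mom: "\<And>i. 1 \<le> i \<Longrightarrow> i \<le> n \<Longrightarrow> integrable M (\<lambda>x. \<bar>X i x\<bar> powr p)"
    and centred: "\<And>i. 1 \<le> i \<Longrightarrow> i \<le> n \<Longrightarrow> (\<integral>x. X i x \<partial>M) = 0"
    and b: "\<And>k. 0 < b k" "\<And>k. 1 \<le> k \<Longrightarrow> k < n \<Longrightarrow> rho_coeff M n X k powr (2 / p) \<le> b k"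
  shows "(\<integral>x. \<bar>A_cond M F X n j x\<bar> powr p \<partial>M)
    \<le> 2 powr (p - 2) * (\<Sum>k=1..n-1. b k) powr (p - 1)
        * (\<Sum>k=1..n-j. b k * (\<integral>x. \<bar>X (j + k) x\<bar> powr p \<partial>M))"
proof -
  interpret finite_measure_subalgebra M "F j" using F by unfold_locales
  define h where "h = (\<lambda>k. real_cond_exp M (F j) (X (j + k)))"
  define m where "m = (\<lambda>k. \<integral>x. \<bar>X (j + k) x\<bar> powr p \<partial>M)"
  have range: "1 \<le> j + k \<and> j + k \<le> n \<and> k < n" if "k \<in> {1..n-j}" for k using that j by auto
  have bound: "integrable M (\<lambda>x. \<bar>h k x\<bar> powr p) \<and>
      (\<integral>x. \<bar>h k x\<bar> powr p \<partial>M) \<le> 2 powr (p - 2) * b k powr p * m k" if k: "k \<in> {1..n-j}" for k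
  proof -
    let ?B = "generated_sigma M X {j+k..n}"
    have sB: "subalgebra M ?B" using meas j k by (intro subalgebra_generated_sigma) auto
    have mX: "X (j + k) \<in> borel_measurable ?B" using k by (intro measurable_generated_sigma) auto
    define r where "r = max_corr M (F j) ?B"
    have r0: "0 \<le> r" unfolding r_def by (rule max_corr_nonneg[OF F sB])
    \<comment> \<open>Here \<open>rho_compatible\<close> passes from the coefficient of
      \<open>F j\<close> to that of the vector.\<close>
    have rr: "r \<le> rho_coeff M n X k"
      using compat j k unfolding rho_compatible_def r_def by auto
    note ce = cond_exp_powr_interpolation[OF F sB r0 p _ mX mom centred,
        OF abs_corr_le_max_corr(2)[OF F sB, folded r_def]]
    have "r powr (2 / p) \<le> b k"
      using b(2)[of k] range[OF k] k powr_mono2[OF _ r0 rr, of "2 / p"] p by auto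
    then have "(r powr (2 / p)) powr p \<le> b k powr p" using p by (intro powr_mono2) auto
    then have "r\<^sup>2 \<le> b k powr p" using p r0 by (simp add: powr_powr)
    then have "2 powr (p - 2) * r\<^sup>2 * m k \<le> 2 powr (p - 2) * b k powr p * m k"
      by (intro mult_right_mono mult_left_mono) (auto simp: m_def)
    then show ?thesis using ce range[OF k] unfolding h_def m_def by (auto intro: order_trans)
  qed
  define S where "S = (\<Sum>k=1..n-j. b k)"
  have AE_A: "AE x in M. A_cond M F X n j x = (\<Sum>k=1..n-j. h k x)"
  proof -
    \<comment> \<open>Padding with 0 makes every member of the family integrable, as linearity over
      the sum asks for all indices; nothing is known about \<open>X\<close> beyond
      \<open>n\<close>.\<close>
    define X' where "X' = (\<lambda>k. if k \<in> {1..n-j} then X (j + k) else (\<lambda>_. 0))"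
    have "integrable M (X' k)" for k
    proof (cases "k \<in> {1..n-j}")
      case True
      then show ?thesis using range[OF True] p
        by (auto simp: X'_def intro!: integrable_of_powr[of p] meas mom)
    next
      case False
      then show ?thesis unfolding X'_def by (simp only: if_False) simp
    qed
    then have "AE x in M. real_cond_exp M (F j) (\<lambda>x. \<Sum>k=1..n-j. X' k x) x
        = (\<Sum>k=1..n-j. real_cond_exp M (F j) (X' k) x)"
      by (rule real_cond_exp_sum)
    moreover have "(\<lambda>x. \<Sum>k=1..n-j. X' k x) = (\<lambda>x. partial_sum X n x - partial_sum X j x)"
    proof
      fix x
      have "(\<Sum>k=1..n-j. X' k x) = (\<Sum>k=1..n-j. X (k + j) x)"
        by (intro sum.cong) (auto simp: X'_def add.commute)
      also have "\<dots> = (\<Sum>i=1+j..n-j+j. X i x)" by (rule sum.shift_bounds_cl_nat_ivl[symmetric])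
      also have "\<dots> = partial_sum X n x - partial_sum X j x"
      proof -
        have "{1..n} = {1..j} \<union> {1+j..n-j+j}" using j by auto
        then have "partial_sum X n x = partial_sum X j x + (\<Sum>i=1+j..n-j+j. X i x)"
          unfolding partial_sum_def by (simp add: sum.union_disjoint)
        then show ?thesis by simp
      qed
      finally show "(\<Sum>k=1..n-j. X' k x) = partial_sum X n x - partial_sum X j x" .
    qed
    moreover have "(\<Sum>k=1..n-j. real_cond_exp M (F j) (X' k) x) = (\<Sum>k=1..n-j. h k x)" for x
      by (intro sum.cong) (auto simp: X'_def h_def)
    ultimately show ?thesis unfolding A_cond_def by simp
  qed
  \<comment> \<open>Weighted Jensen almost everywhere. Its factor \<open>b k powr (1 - p)\<close>
    will meet \<open>b k powr p\<close> from the moment bound, leaving a single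
    \<open>b k\<close>.\<close>
  have "(\<integral>x. \<bar>A_cond M F X n j x\<bar> powr p \<partial>M)
      \<le> (\<integral>x. S powr (p - 1) * (\<Sum>k=1..n-j. b k powr (1 - p) * \<bar>h k x\<bar> powr p) \<partial>M)"
  proof (rule integral_mono_AE')
    show "integrable M (\<lambda>x. S powr (p - 1) * (\<Sum>k=1..n-j. b k powr (1 - p) * \<bar>h k x\<bar> powr p))"
      using bound by auto
    show "AE x in M. \<bar>A_cond M F X n j x\<bar> powr p
        \<le> S powr (p - 1) * (\<Sum>k=1..n-j. b k powr (1 - p) * \<bar>h k x\<bar> powr p)"
      using AE_A unfolding S_def
    proof eventually_elim
      case (elim x)
      show ?case unfolding elim using p b(1) by (intro abs_sum_powr_le_weighted) auto
    qed
  qed (auto intro!: AE_I2 mult_nonneg_nonneg sum_nonneg)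
  also have "\<dots> = S powr (p - 1) * (\<Sum>k=1..n-j. b k powr (1 - p) * (\<integral>x. \<bar>h k x\<bar> powr p \<partial>M))"
    using bound by simp
  also have "\<dots> \<le> S powr (p - 1) * (\<Sum>k=1..n-j. b k powr (1 - p) * (2 powr (p - 2) * b k powr p * m k))"
    using bound by (intro mult_left_mono sum_mono) auto
  also have "\<dots> = S powr (p - 1) * (2 powr (p - 2) * (\<Sum>k=1..n-j. b k * m k))"
  proof -
    have "b k powr (1 - p) * (2 powr (p - 2) * b k powr p * m k) = 2 powr (p - 2) * (b k * m k)" for k
    proof -
      have "b k powr (1 - p) * b k powr p = b k" using b(1)[of k] by (simp flip: powr_add)
      then show ?thesis by (metis mult.assoc mult.left_commute)
    qed
    then show ?thesis by (simp only: sum_distrib_left)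
  qed
  \<comment> \<open>Enlarging the weight sum to \<open>n - 1\<close> makes the prefactor independent
    of \<open>j\<close>, ready for summation over \<open>j\<close>.\<close>
  also have "\<dots> \<le> (\<Sum>k=1..n-1. b k) powr (p - 1) * (2 powr (p - 2) * (\<Sum>k=1..n-j. b k * m k))"
  proof (intro mult_right_mono powr_mono2)
    have b0: "0 \<le> b k" for k using b(1) by (rule less_imp_le)
    show "0 \<le> S" unfolding S_def by (intro sum_nonneg b0)
    show "S \<le> (\<Sum>k=1..n-1. b k)" unfolding S_def using j by (intro sum_mono2 b0) auto
    show "0 \<le> 2 powr (p - 2) * (\<Sum>k=1..n-j. b k * m k)"
      unfolding m_def by (intro mult_nonneg_nonneg sum_nonneg b0) auto
  qed (use p in auto)
  finally show ?thesis by (simp add: m_def mult_ac)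
qed

end

text \<open>For \<open>k < n\<close> the index \<open>s = 1\<close> is admissible, so the maximum
  dominates a nonnegative coefficient. Monotonicity of \<open>powr\<close> in the second bound
  relies on this.\<close>

lemma rho_coeff_nonneg:
  assumes "prob_space M" and "\<And>i. 1 \<le> i \<Longrightarrow> i \<le> n \<Longrightarrow> X i \<in> borel_measurable M"
    and "1 \<le> k" "k < n"
  shows "0 \<le> rho_coeff M n X k"
proof -
  have "finite {s. 1 \<le> s \<and> s + k \<le> n}" by (rule finite_subset[of _ "{..n}"]) auto
  then have "max_corr M (generated_sigma M X {1..1}) (generated_sigma M X {1+k..n}) \<le> rho_coeff M n X k"
    unfolding rho_coeff_def using assms(3,4) by (intro Max_ge finite_imageI image_eqI[where x = 1]) auto
  moreover have "0 \<le> max_corr M (generated_sigma M X {1..1}) (generated_sigma M X {1+k..n})"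
    using assms by (intro prob_space.max_corr_nonneg subalgebra_generated_sigma) auto
  ultimately show ?thesis by linarith
qed

theorem lemma16:
  fixes M :: "'a measure" and F :: "nat \<Rightarrow> 'a measure"
    and X :: "nat \<Rightarrow> 'a \<Rightarrow> real" and n :: nat and p :: real
  assumes "prob_space M"
    and "1 \<le> n"
    and "\<And>j. j \<le> n \<Longrightarrow> subalgebra M (F j)"
    and "\<And>i j. i \<le> j \<Longrightarrow> j \<le> n \<Longrightarrow> sets (F i) \<subseteq> sets (F j)"
    and "sets (F 0) = {{}, space M}"
    and "\<And>j. 1 \<le> j \<Longrightarrow> j \<le> n \<Longrightarrow> X j \<in> borel_measurable (F j)"
    and "rho_compatible M n F X"
    and "2 \<le> p"
    and "\<And>j. 1 \<le> j \<Longrightarrow> j \<le> n \<Longrightarrow> integrable M (\<lambda>x. \<bar>X j x\<bar> powr p)"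
    and "\<And>j. 1 \<le> j \<Longrightarrow> j \<le> n \<Longrightarrow> (\<integral>x. X j x \<partial>M) = 0"
  shows "(\<Sum>j=1..n. \<integral>x. \<bar>A_cond M F X n j x\<bar> powr p \<partial>M)
           \<le> 2 powr (p - 2) * (\<Sum>k=1..n-1. rho_coeff M n X k powr (2 / p)) powr p
               * (\<Sum>i=1..n. \<integral>x. \<bar>X i x\<bar> powr p \<partial>M)
       \<and> (\<forall>\<rho>::real. 0 < \<rho> \<and> \<rho> < 1 \<and> (\<forall>k\<in>{1..n-1}. rho_coeff M n X k \<le> \<rho> ^ k) \<longrightarrow>
            (\<Sum>j=1..n. \<integral>x. \<bar>A_cond M F X n j x\<bar> powr p \<partial>M)
              \<le> p powr p * (1 / (4 * (1 - \<rho>) powr p))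
                  * (\<Sum>i=1..n. \<integral>x. \<bar>X i x\<bar> powr p \<partial>M))"
proof -
  interpret prob_space M by fact
  note p = \<open>2 \<le> p\<close>
  have meas: "X i \<in> borel_measurable M" if "1 \<le> i" "i \<le> n" for i
    using measurable_from_subalg[OF assms(3) assms(6)] that by auto
  define m where "m = (\<lambda>i. \<integral>x. \<bar>X i x\<bar> powr p \<partial>M)"
  define L where "L = (\<Sum>j=1..n. \<integral>x. \<bar>A_cond M F X n j x\<bar> powr p \<partial>M)"
  define T where "T = (\<Sum>i=1..n. m i)"
  define a where "a = (\<lambda>k. rho_coeff M n X k powr (2 / p))"
  have m0: "0 \<le> m i" for i by (simp add: m_def)
  have T0: "0 \<le> T" unfolding T_def by (intro sum_nonneg m0)
  have a0: "0 \<le> a k" for k by (simp add: a_def)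
  have key: "L \<le> 2 powr (p - 2) * (\<Sum>k=1..n-1. a k + e) powr p * T" if e: "e > 0" for e
  proof -
    define b where "b = (\<lambda>k. a k + e)"
    define S where "S = (\<Sum>k=1..n-1. b k)"
    have b: "0 < b k" "a k \<le> b k" for k using a0[of k] e by (auto simp: b_def)
    have S0: "0 \<le> S" unfolding S_def by (intro sum_nonneg less_imp_le b)
    have "L \<le> (\<Sum>j=1..n. 2 powr (p - 2) * S powr (p - 1) * (\<Sum>k=1..n-j. b k * m (j + k)))"
      unfolding L_def m_def S_def
      by (intro sum_mono A_cond_powr_le) (use assms meas b a_def in auto)
    also have "\<dots> = 2 powr (p - 2) * S powr (p - 1) * (\<Sum>j=1..n. \<Sum>k=1..n-j. b k * m (j + k))"
      by (rule sum_distrib_left[symmetric])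
    also have "\<dots> \<le> 2 powr (p - 2) * S powr (p - 1) * (S * T)"
      unfolding S_def T_def by (intro mult_left_mono[OF sum_shifted_product_le]) (auto simp: m0 b less_imp_le)
    also have "\<dots> = 2 powr (p - 2) * (S * S powr (p - 1)) * T" by (simp only: mult_ac)
    also have "S * S powr (p - 1) = S powr p" using S0 by (simp add: powr_mult_base)
    finally show ?thesis by (simp only: S_def b_def)
  qed
  \<comment> \<open>Let the shift \<open>e\<close> of the weights tend to 0. Since
    \<open>p > 0\<close>, the power is continuous also where the sum of the \<open>a k\<close> is 0,
    as for \<open>n = 1\<close>, where it is empty.\<close>
  have "((\<lambda>e. 2 powr (p - 2) * (\<Sum>k=1..n-1. a k + e) powr p * T) \<longlongrightarrow>
      2 powr (p - 2) * (\<Sum>k=1..n-1. a k + 0) powr p * T) (at_right 0)"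
    using p a0 by (intro tendsto_mult tendsto_powr' tendsto_sum tendsto_add tendsto_const tendsto_ident_at)
      (auto intro!: eventually_mono[OF eventually_at_right_less[of "0::real"]] sum_nonneg add_nonneg_nonneg)
  then have "L \<le> 2 powr (p - 2) * (\<Sum>k=1..n-1. a k + 0) powr p * T"
    by (rule tendsto_lowerbound[OF _ eventually_mono[OF eventually_at_right_less key]]) simp_all
  then have first: "L \<le> 2 powr (p - 2) * (\<Sum>k=1..n-1. a k) powr p * T" by simp
  have second: "L \<le> p powr p * (1 / (4 * (1 - \<rho>) powr p)) * T"
    if \<rho>: "0 < \<rho>" "\<rho> < 1" and le: "\<And>k. k \<in> {1..n-1} \<Longrightarrow> rho_coeff M n X k \<le> \<rho> ^ k" for \<rho> :: real
  proof -
    have "(\<Sum>k=1..n-1. a k) \<le> (\<Sum>k=1..n-1. (\<rho> ^ k) powr (2 / p))"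
      unfolding a_def
    proof (intro sum_mono powr_mono2 le)
      fix k assume "k \<in> {1..n-1}"
      then show "0 \<le> rho_coeff M n X k" using assms(2) by (intro rho_coeff_nonneg assms(1) meas) auto
    qed (use p in auto)
    also have "\<dots> \<le> p / (2 * (1 - \<rho>))" by (rule geometric_sum_powr_le[OF p \<rho>])
    finally have "(\<Sum>k=1..n-1. a k) powr p \<le> (p / (2 * (1 - \<rho>))) powr p"
      using p a0 by (intro powr_mono2 sum_nonneg) auto
    then have "2 powr (p - 2) * (\<Sum>k=1..n-1. a k) powr p * T
        \<le> 2 powr (p - 2) * (p / (2 * (1 - \<rho>))) powr p * T"
      using T0 by (intro mult_right_mono mult_left_mono) auto
    also have "(p / (2 * (1 - \<rho>))) powr p = p powr p / (2 powr p * (1 - \<rho>) powr p)"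
      using p \<rho> by (simp only: powr_divide powr_mult)
    \<comment> \<open>The 4 arises as the quotient of \<open>2 powr p\<close>, from the geometric
      series, by \<open>2 powr (p - 2)\<close>.\<close>
    also have "2 powr (p - 2) * (p powr p / (2 powr p * (1 - \<rho>) powr p)) = p powr p * (1 / (4 * (1 - \<rho>) powr p))"
      by (simp add: powr_diff)
    finally show ?thesis using first by linarith
  qed
  show ?thesis
    using first second unfolding L_def a_def T_def m_def by blast
qed

end
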